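(* Let $1<p\le 3/2$ and let $u$ be a smooth, non-negative, spatially fast decaying solution of the Cauchy problem $$\partial_t u=-\frac{1}{p-1}\left(u^p\left(u^{p-1}\right)_{xx}\right)_{xx},\qquad x\in\mathbb{R},\ t>0,\qquad u(\cdot,0)=u_0\ge 0,$$ with initial data of unit mass, $\int_{\mathbb{R}}u_0\,\mathrm{d}x=1$, and finite second moment $\Theta_0=\int_{\mathbb{R}}x^2u_0\,\mathrm{d}x$. Let $\Theta(u(t))=\int_{\mathbb{R}}x^2u(x,t)\,\mathrm{d}x$, let $B_p$ be the Barenblatt profile of unit mass with second moment $\Theta_0$, and let $U_p(t)$ be the rescaled Barenblatt profile having the same second moment as $u(t)$. Then (by a formal calculation for such solutions) $$\mathcal{R}_p(u(t)\,|\,U_p(t))\leq-\frac12\ln\left(1-\left(1-\exp\left(-2\,\mathcal{R}_p(u_0\,|\,B_p)\right)\right)\frac{\Theta_0}{\Theta(u(t))}\right),\qquad t>0.$$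
   Context: For a probability density $f$ on $\mathbb{R}$ and $p\ne1$, the Rényi entropy of order $p$ is $\mathcal{R}_p(f)=\frac{1}{1-p}\ln\left(\int_{\mathbb{R}}f^p\,\mathrm{d}x\right)$. If $B$ is the Barenblatt profile of unit mass with the same second moment as $f$, the relative Rényi entropy is $\mathcal{R}_p(f|B)=\mathcal{R}_p(B)-\mathcal{R}_p(f)$, which is nonnegative. The Barenblatt profile of second moment $\Theta_0$ is $$B_p(y)=\left(C_p-\frac{p-1}{p}\,\frac{y^2}{2\sigma}\right)_+^{1/(p-1)},\qquad (\cdot)_+=\max\{\cdot,0\},$$ where the constants $C_p>0$ and $\sigma>0$ are such that $B_p$ has unit mass and second moment $\Theta_0$. The rescaled profile is $$U_p(x,t)=\left(\frac{\Theta(u(t))}{\Theta_0}\right)^{-1/2}\left(C_p-\frac{p-1}{p}\,\frac{\Theta_0}{\Theta(u(t))}\,\frac{x^2}{2\sigma_t}\right)_+^{1/(p-1)},$$ where $\sigma_t>0$ is such that the second moment of $U_p(\cdot,t)$ equals $\Theta(u(t))$. *)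

theory Defs
  imports "HOL-Analysis.Analysis"
begin

definition renyi_entropy :: "real \<Rightarrow> (real \<Rightarrow> real) \<Rightarrow> real" where
  "renyi_entropy p f = 1 / (1 - p) * ln (LINT x|lborel. f x powr p)"

definition relative_renyi_entropy :: "real \<Rightarrow> (real \<Rightarrow> real) \<Rightarrow> (real \<Rightarrow> real) \<Rightarrow> real" where
  "relative_renyi_entropy p f B = renyi_entropy p B - renyi_entropy p f"

definition second_moment :: "(real \<Rightarrow> real) \<Rightarrow> real" where
  "second_moment f = (LINT x|lborel. x\<^sup>2 * f x)"

definition barenblatt :: "real \<Rightarrow> real \<Rightarrow> real \<Rightarrow> real \<Rightarrow> real" where
  "barenblatt p C \<sigma> y = (max 0 (C - (p - 1) / p * (y\<^sup>2 / (2 * \<sigma>)))) powr (1 / (p - 1))"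

definition rescaled_barenblatt ::
    "real \<Rightarrow> real \<Rightarrow> real \<Rightarrow> real \<Rightarrow> real \<Rightarrow> real \<Rightarrow> real" where
  "rescaled_barenblatt p C \<sigma> \<Theta>0 \<Theta> x =
     (\<Theta> / \<Theta>0) powr (- 1 / 2) *
     (max 0 (C - (p - 1) / p * (\<Theta>0 / \<Theta>) * (x\<^sup>2 / (2 * \<sigma>)))) powr (1 / (p - 1))"

text \<open>Functions of space and time are written \<open>u x t\<close>.\<close>

definition dx :: "(real \<Rightarrow> real \<Rightarrow> real) \<Rightarrow> real \<Rightarrow> real \<Rightarrow> real" where
  "dx f = (\<lambda>x t. deriv (\<lambda>y. f y t) x)"

definition dt :: "(real \<Rightarrow> real \<Rightarrow> real) \<Rightarrow> real \<Rightarrow> real \<Rightarrow> real" where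
  "dt f = (\<lambda>x t. deriv (\<lambda>s. f x s) t)"

inductive_set iterated_partials :: "(real \<Rightarrow> real \<Rightarrow> real) \<Rightarrow> (real \<Rightarrow> real \<Rightarrow> real) set"
  for u :: "real \<Rightarrow> real \<Rightarrow> real" where
  "u \<in> iterated_partials u"
| "f \<in> iterated_partials u \<Longrightarrow> dx f \<in> iterated_partials u"
| "f \<in> iterated_partials u \<Longrightarrow> dt f \<in> iterated_partials u"

definition smooth_for_positive_times :: "(real \<Rightarrow> real \<Rightarrow> real) \<Rightarrow> bool" where
  "smooth_for_positive_times u \<longleftrightarrow>
     (\<forall>f\<in>iterated_partials u.
        continuous_on (UNIV \<times> {0<..}) (\<lambda>(x, t). f x t) \<and>
        (\<forall>x t. t > 0 \<longrightarrow>
           (\<lambda>y. f y t) differentiable at x \<and> (\<lambda>s. f x s) differentiable at t))"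

definition rapidly_decaying_on :: "real set \<Rightarrow> (real \<Rightarrow> real \<Rightarrow> real) \<Rightarrow> bool" where
  "rapidly_decaying_on I f \<longleftrightarrow>
     (\<forall>k::nat. \<exists>M. \<forall>x. \<forall>t\<in>I. \<bar>x\<bar> ^ k * \<bar>f x t\<bar> \<le> M)"

text \<open>Up to the initial time only \<open>u\<close> itself has to decay, not its derivatives.\<close>

definition spatially_fast_decaying :: "(real \<Rightarrow> real \<Rightarrow> real) \<Rightarrow> bool" where
  "spatially_fast_decaying u \<longleftrightarrow>
     (\<forall>T>0. rapidly_decaying_on {0..T} u) \<and>
     (\<forall>f\<in>iterated_partials u. \<forall>a>0. \<forall>T. rapidly_decaying_on {a..T} f)"

definition twice_differentiable_in_space :: "(real \<Rightarrow> real \<Rightarrow> real) \<Rightarrow> bool" where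
  "twice_differentiable_in_space f \<longleftrightarrow>
     (\<forall>x t. t > 0 \<longrightarrow>
        (\<lambda>y. f y t) differentiable at x \<and> (\<lambda>y. dx f y t) differentiable at x)"

definition flux :: "real \<Rightarrow> (real \<Rightarrow> real \<Rightarrow> real) \<Rightarrow> real \<Rightarrow> real \<Rightarrow> real" where
  "flux p u = (\<lambda>x t. u x t powr p * dx (dx (\<lambda>y s. u y s powr (p - 1))) x t)"

text \<open>
  Where \<open>u\<close> vanishes, smoothness of \<open>u\<close> does not make the derivatives in the equation
  exist, because \<open>p - 1 < 1\<close>; and \<open>deriv\<close> is unspecified at points of
  non-differentiability.  Their existence is therefore part of being a solution; where
  \<open>u\<close> is smooth and positive it is automatic.
\<close>

definition solves_equation :: "real \<Rightarrow> (real \<Rightarrow> real \<Rightarrow> real) \<Rightarrow> bool" where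
  "solves_equation p u \<longleftrightarrow>
     twice_differentiable_in_space (\<lambda>x t. u x t powr (p - 1)) \<and>
     twice_differentiable_in_space (flux p u) \<and>
     (\<forall>x t. t > 0 \<longrightarrow> dt u x t = - (1 / (p - 1)) * dx (dx (flux p u)) x t)"

definition solves_cauchy_problem ::
    "real \<Rightarrow> (real \<Rightarrow> real) \<Rightarrow> (real \<Rightarrow> real \<Rightarrow> real) \<Rightarrow> bool" where
  "solves_cauchy_problem p u0 u \<longleftrightarrow>
     solves_equation p u \<and>
     continuous_on (UNIV \<times> {0..}) (\<lambda>(x, t). u x t) \<and>
     (\<forall>x. u x 0 = u0 x)"

end

theory Submission
  imports Defs "HOL-Probability.Sinc_Integral"
begin

text \<open>
  Let \<open>E = \<integral> u\<^sup>p\<close>, \<open>v = u\<^bsup>p-1\<^esup>\<close>, \<open>w = u\<^sup>p v\<^sub>x\<^sub>x\<close> and \<open>J = \<integral> u v\<^sub>x\<^sup>2\<close>.  Along the flow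
  \<open>\<Theta>' = - 2/(p-1) \<integral> w = 2p/(p-1)\<^sup>2 J\<close> and, by Cauchy-Schwarz,
  \<open>E' \<le> - p/(p-1) (\<integral> w)\<^sup>2 / E\<close>.  Transporting \<open>u\<close> onto a rescaling of the Barenblatt profile \<open>B\<close> gives the
  sharp Gagliardo-Nirenberg inequality
  \<open>(p-1)\<^sup>2 E\<^sup>2 \<le> p\<^sup>2 (E\<^sub>B/E)\<^bsup>2/(p-1)\<^esup> \<Theta>\<^sub>0 J\<close>.  Together these say that \<open>G = \<Theta>\<^sub>0 (E\<^sub>B/E)\<^bsup>2/(p-1)\<^esup>\<close>
  satisfies \<open>G' \<ge> \<Theta>'\<close>.  Since \<open>exp (-2 R\<^sub>p(u|U)) = G/\<Theta>\<close>, integrating from time 0 yields the claim.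
\<close>

section \<open>Integration on the line and rapidly decaying functions\<close>

text \<open>The exponent \<open>2 / (p - 1)\<close> comes from scaling: a mass-preserving dilation
  by \<open>r\<close> multiplies \<open>E\<close> by \<open>r powr (1 - p)\<close> and the second
  moment by \<open>r ^ 2\<close>. So \<open>G\<close> is the second moment of the dilated Barenblatt
  profile that has the same \<open>E\<close> as \<open>u\<close>. Dilated Barenblatt profiles are
  the case of equality: there the transport map is linear on the support and
  \<open>v\<^sub>x\<close> is proportional to it, which saturates Cauchy-Schwarz. The obstacle is
  regularity at the zeros of \<open>u\<close>. Since \<open>p - 1 < 1\<close>, the power
  \<open>v\<close> has two derivatives there only by hypothesis, the second may be discontinuous,
  and no decay of \<open>v\<^sub>x\<close> is available. Integrations by parts and changes of
  variables are therefore replaced by functions on the line whose derivative is known or has a sign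
  and whose values near both ends are compared. Decay is recovered after multiplication by powers of
  \<open>u\<close>, through \<open>u\<^sub>x\<^sup>2 \<le> 4 M u\<close> for nonnegative
  \<open>u\<close> with \<open>u\<^sub>x\<^sub>x\<close> bounded by \<open>M\<close>.\<close>

lemma integrable_inverse_quadratic: "integrable lborel (\<lambda>x::real. M * inverse (1 + x\<^sup>2))"
  using integrable_inverse_1_plus_square by (simp add: set_integrable_def)

lemma integrable_quadratic_decay:
  fixes f :: "real \<Rightarrow> real"
  assumes [measurable]: "f \<in> borel_measurable borel"
    and b: "\<And>x. (1 + x\<^sup>2) * \<bar>f x\<bar> \<le> M"
  shows "integrable lborel f"
proof (rule Bochner_Integration.integrable_bound)
  show "integrable lborel (\<lambda>x. M * inverse (1 + x\<^sup>2))" by (rule integrable_inverse_quadratic)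
  have "\<bar>f x\<bar> \<le> M * inverse (1 + x\<^sup>2)" for x
  proof -
    have "0 < 1 + x\<^sup>2" by (simp add: add_pos_nonneg)
    with b[of x] show ?thesis by (simp add: field_simps)
  qed
  then show "AE x in lborel. norm (f x) \<le> norm (M * inverse (1 + x\<^sup>2))"
    by (intro AE_I2) (smt (verit) real_norm_def)
qed simp

text \<open>Dominated convergence over growing intervals, with dominating function
  \<open>|f|\<close>, gives both limits of an arbitrary antiderivative, which is then shifted so
  that it vanishes at \<open>at_bot\<close>. Inequalities between integrals thereby become
  monotonicity statements about primitives.\<close>

lemma integrable_imp_primitive:
  fixes f :: "real \<Rightarrow> real"
  assumes cont: "continuous_on UNIV f" and int: "integrable lborel f"
  obtains F where "\<And>x. (F has_real_derivative f x) (at x)"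
    "(F \<longlongrightarrow> 0) at_bot" "(F \<longlongrightarrow> (LINT x|lborel. f x)) at_top"
proof -
  have ic: "isCont f x" for x
    using cont by (simp add: continuous_on_eq_continuous_at)
  note [measurable] = borel_measurable_continuous_onI[OF cont]
  obtain F where F: "\<And>x. (F has_real_derivative f x) (at x)"
    using einterval_antiderivative[of "-\<infinity>" "\<infinity>" f] ic
    by (auto simp: has_real_derivative_iff_has_vector_derivative)
  have FTC: "F b - F a = (LINT x|lborel. indicator {a..b} x * f x)" if "a \<le> b" for a b
    using integral_FTC_Icc_real[OF that, of F f] F ic by (auto simp: mult.commute)
  \<comment> \<open>The moving set and its limit have to agree only eventually, for each fixed point
    separately.\<close>
  have dom: "((\<lambda>t. LINT x|lborel. indicator (A t) x * f x) \<longlongrightarrow> (LINT x|lborel. indicator B x * f x)) at_top"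
    if [measurable]: "\<And>t. A t \<in> sets borel" "B \<in> sets borel"
      and ev: "\<And>x. \<forall>\<^sub>F t in at_top. x \<in> A t \<longleftrightarrow> x \<in> B" for A :: "real \<Rightarrow> real set" and B
  proof (rule integral_dominated_convergence_at_top[where w = "\<lambda>x. \<bar>f x\<bar>"])
    show "integrable lborel (\<lambda>x. \<bar>f x\<bar>)" using int by simp
    show "AE x in lborel. ((\<lambda>t. indicator (A t) x * f x) \<longlongrightarrow> indicator B x * f x) at_top"
    proof (intro AE_I2 tendsto_eventually)
      fix x show "\<forall>\<^sub>F t in at_top. indicator (A t) x * f x = indicator B x * f x"
        using ev[of x] by eventually_elim (auto simp: indicator_def)
    qed
    show "\<forall>\<^sub>F i in at_top. AE x in lborel. norm (indicator (A i) x * f x) \<le> \<bar>f x\<bar>"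
      by (intro always_eventually allI AE_I2) (auto simp: indicator_def)
  qed auto
  define L where "L = F 0 - (LINT x|lborel. indicator {..0} x * f x)"
  have "((\<lambda>t. LINT x|lborel. indicator {-t..0} x * f x) \<longlongrightarrow> (LINT x|lborel. indicator {..0} x * f x)) at_top"
  proof (intro dom)
    fix x :: real show "\<forall>\<^sub>F t in at_top. x \<in> {-t..0} \<longleftrightarrow> x \<in> {..0}"
      using eventually_ge_at_top[of "- x"] by eventually_elim auto
  qed auto
  moreover have "\<forall>\<^sub>F t in at_top. (LINT x|lborel. indicator {-t..0} x * f x) = F 0 - F (- t)"
    using eventually_ge_at_top[of 0] by eventually_elim (simp add: FTC)
  ultimately have "((\<lambda>t. F 0 - F (- t)) \<longlongrightarrow> (LINT x|lborel. indicator {..0} x * f x)) at_top"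
    by (rule Lim_transform_eventually)
  from tendsto_diff[OF tendsto_const[of "F 0"] this]
  have bot': "((\<lambda>t. F (- t)) \<longlongrightarrow> L) at_top" by (simp add: L_def)
  then have bot: "(F \<longlongrightarrow> L) at_bot" by (simp add: filterlim_at_bot_mirror)
  have "((\<lambda>t. LINT x|lborel. indicator {-t..t} x * f x) \<longlongrightarrow> (LINT x|lborel. indicator UNIV x * f x)) at_top"
  proof (intro dom)
    fix x :: real show "\<forall>\<^sub>F t in at_top. x \<in> {-t..t} \<longleftrightarrow> x \<in> UNIV"
      using eventually_ge_at_top[of "\<bar>x\<bar>"] by eventually_elim auto
  qed auto
  moreover have "\<forall>\<^sub>F t in at_top. (LINT x|lborel. indicator {-t..t} x * f x) = F t - F (- t)"
    using eventually_ge_at_top[of 0] by eventually_elim (simp add: FTC)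
  ultimately have "((\<lambda>t. F t - F (- t)) \<longlongrightarrow> (LINT x|lborel. f x)) at_top"
    by (simp add: Lim_transform_eventually)
  from tendsto_add[OF this bot'] have top: "(F \<longlongrightarrow> (LINT x|lborel. f x) + L) at_top" by simp
  show thesis
  proof
    show "((\<lambda>x. F x - L) has_real_derivative f x) (at x)" for x
      using DERIV_diff[OF F DERIV_const] by simp
    show "((\<lambda>x. F x - L) \<longlongrightarrow> 0) at_bot"
      using tendsto_diff[OF bot tendsto_const[of L]] by simp
    show "((\<lambda>x. F x - L) \<longlongrightarrow> (LINT x|lborel. f x)) at_top"
      using tendsto_diff[OF top tendsto_const[of L]] by simp
  qed
qed

text \<open>\<open>F\<close> differs by a constant from the primitive that vanishes at
  \<open>at_bot\<close>. In later uses \<open>F\<close> collects the boundary terms of an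
  integration by parts and both limits are 0.\<close>

lemma integral_FTC_line:
  fixes f F :: "real \<Rightarrow> real"
  assumes cont: "continuous_on UNIV f" and int: "integrable lborel f"
    and F: "\<And>x. (F has_real_derivative f x) (at x)"
    and bot: "(F \<longlongrightarrow> a) at_bot" and top: "(F \<longlongrightarrow> b) at_top"
  shows "(LINT x|lborel. f x) = b - a"
proof -
  obtain G where G: "\<And>x. (G has_real_derivative f x) (at x)"
    "(G \<longlongrightarrow> 0) at_bot" "(G \<longlongrightarrow> (LINT x|lborel. f x)) at_top"
    using integrable_imp_primitive[OF cont int] by blast
  have "((\<lambda>x. F x - G x) has_real_derivative 0) (at x)" for x
    using DERIV_diff[OF F G(1)] by simp
  then obtain c where eq: "\<And>x. F x - G x = c"
    using DERIV_isconst_all[of "\<lambda>x. F x - G x"] by blast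
  have "((\<lambda>_::real. c) \<longlongrightarrow> a - 0) at_bot" "((\<lambda>_::real. c) \<longlongrightarrow> b - (LINT x|lborel. f x)) at_top"
    using tendsto_diff[OF bot G(2)] tendsto_diff[OF top G(3)] unfolding eq .
  then show ?thesis by (simp add: tendsto_const_iff)
qed

text \<open>The weight \<open>1 + |x|\<close> is at least 1, so one bound controls \<open>f\<close>
  near the origin as well as at infinity, and a larger \<open>k\<close> always gives a stronger
  bound.\<close>

definition rapid :: "(real \<Rightarrow> real) \<Rightarrow> bool" where
  "rapid f \<longleftrightarrow> (\<forall>k::nat. \<exists>M. \<forall>x. (1 + \<bar>x\<bar>) ^ k * \<bar>f x\<bar> \<le> M)"

section \<open>Closure properties and consequences of rapid decay\<close>

lemma rapidE:
  assumes "rapid f" obtains M where "0 \<le> M" "\<And>x. (1 + \<bar>x\<bar>) ^ k * \<bar>f x\<bar> \<le> M"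
proof -
  obtain M where M: "\<And>x. (1 + \<bar>x\<bar>) ^ k * \<bar>f x\<bar> \<le> M" using assms unfolding rapid_def by blast
  have "0 \<le> (1 + \<bar>0::real\<bar>) ^ k * \<bar>f 0\<bar>" by simp
  with M[of 0] have "0 \<le> M" by linarith
  with M that show thesis by blast
qed

lemma rapid_bounded:
  assumes "rapid f" obtains M where "0 \<le> M" "\<And>x. \<bar>f x\<bar> \<le> M"
  using rapidE[OF assms, of 0] by auto

lemma rapidI:
  assumes "\<And>k::nat. \<exists>M. \<forall>x. \<bar>x\<bar> ^ k * \<bar>f x\<bar> \<le> M"
  shows "rapid f"
  unfolding rapid_def
proof
  fix k :: nat
  obtain M where M: "\<And>x. \<bar>x\<bar> ^ k * \<bar>f x\<bar> \<le> M" using assms by blast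
  obtain N where N: "\<And>x. \<bar>x\<bar> ^ 0 * \<bar>f x\<bar> \<le> N" using assms by blast
  \<comment> \<open>The factor \<open>2 ^ k\<close> comes from
    \<open>1 + |x| \<le> 2 * max 1 |x|\<close>; the maximum is covered by \<open>N\<close> where it
    is 1 and by \<open>M\<close> elsewhere.\<close>
  have "(1 + \<bar>x\<bar>) ^ k * \<bar>f x\<bar> \<le> 2 ^ k * (M + N)" for x
  proof -
    have MN: "0 \<le> M" "0 \<le> N"
      using M[of 1] N[of 1] by (auto intro: order_trans[OF abs_ge_zero])
    have "(1 + \<bar>x\<bar>) ^ k \<le> (2 * max 1 \<bar>x\<bar>) ^ k" by (intro power_mono) auto
    also have "\<dots> = 2 ^ k * max 1 \<bar>x\<bar> ^ k" by (simp add: power_mult_distrib)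
    finally have "(1 + \<bar>x\<bar>) ^ k * \<bar>f x\<bar> \<le> 2 ^ k * (max 1 \<bar>x\<bar> ^ k * \<bar>f x\<bar>)"
      by (metis abs_ge_zero mult.assoc mult_right_mono)
    also have "max 1 \<bar>x\<bar> ^ k * \<bar>f x\<bar> \<le> M + N"
      using M[of x] N[of x] MN by (auto simp: max_def)
    finally show ?thesis by simp
  qed
  then show "\<exists>M. \<forall>x. (1 + \<bar>x\<bar>) ^ k * \<bar>f x\<bar> \<le> M" by blast
qed

lemma rapid_mono:
  assumes "rapid f" "\<And>x. \<bar>g x\<bar> \<le> c * \<bar>f x\<bar>"
  shows "rapid g"
  unfolding rapid_def
proof
  fix k :: nat
  obtain M where M: "\<And>x. (1 + \<bar>x\<bar>) ^ k * \<bar>f x\<bar> \<le> M" using rapidE[OF assms(1)] by blast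
  have "(1 + \<bar>x\<bar>) ^ k * \<bar>g x\<bar> \<le> \<bar>c\<bar> * M" for x
  proof -
    have "\<bar>g x\<bar> \<le> \<bar>c\<bar> * \<bar>f x\<bar>"
      using assms(2)[of x] by (meson abs_ge_self abs_ge_zero mult_right_mono order_trans)
    then have "(1 + \<bar>x\<bar>) ^ k * \<bar>g x\<bar> \<le> (1 + \<bar>x\<bar>) ^ k * (\<bar>c\<bar> * \<bar>f x\<bar>)"
      by (intro mult_left_mono) auto
    also have "\<dots> = \<bar>c\<bar> * ((1 + \<bar>x\<bar>) ^ k * \<bar>f x\<bar>)" by (simp add: mult_ac)
    also have "\<dots> \<le> \<bar>c\<bar> * M" by (intro mult_left_mono M) auto
    finally show ?thesis .
  qed
  then show "\<exists>M. \<forall>x. (1 + \<bar>x\<bar>) ^ k * \<bar>g x\<bar> \<le> M" by blast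
qed

lemma rapid_mult_bounded:
  assumes "rapid f" "\<And>x. \<bar>g x\<bar> \<le> c"
  shows "rapid (\<lambda>x. g x * f x)" "rapid (\<lambda>x. f x * g x)"
proof -
  have "\<bar>g x * f x\<bar> \<le> c * \<bar>f x\<bar>" for x
    unfolding abs_mult by (intro mult_right_mono assms) auto
  then show "rapid (\<lambda>x. g x * f x)" by (rule rapid_mono[OF assms(1)])
  then show "rapid (\<lambda>x. f x * g x)" by (simp add: mult.commute)
qed

lemma rapid_mult:
  assumes "rapid f" "rapid g"
  shows "rapid (\<lambda>x. f x * g x)"
  using rapid_bounded[OF assms(2)] rapid_mult_bounded(2)[OF assms(1)] by metis

lemma rapid_cmult: "rapid f \<Longrightarrow> rapid (\<lambda>x. c * f x)"
  by (rule rapid_mult_bounded(1)[where c = "\<bar>c\<bar>"]) auto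

lemma rapid_add:
  assumes "rapid f" "rapid g"
  shows "rapid (\<lambda>x. f x + g x)"
  unfolding rapid_def
proof
  fix k :: nat
  obtain M where M: "\<And>x. (1 + \<bar>x\<bar>) ^ k * \<bar>f x\<bar> \<le> M" using rapidE[OF assms(1)] by blast
  obtain N where N: "\<And>x. (1 + \<bar>x\<bar>) ^ k * \<bar>g x\<bar> \<le> N" using rapidE[OF assms(2)] by blast
  have "(1 + \<bar>x\<bar>) ^ k * \<bar>f x + g x\<bar> \<le> M + N" for x
  proof -
    have "(1 + \<bar>x\<bar>) ^ k * \<bar>f x + g x\<bar> \<le> (1 + \<bar>x\<bar>) ^ k * (\<bar>f x\<bar> + \<bar>g x\<bar>)"
      by (intro mult_left_mono) auto
    with M[of x] N[of x] show ?thesis by (simp add: distrib_left)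
  qed
  then show "\<exists>M. \<forall>x. (1 + \<bar>x\<bar>) ^ k * \<bar>f x + g x\<bar> \<le> M" by blast
qed

lemma rapid_diff: "rapid f \<Longrightarrow> rapid g \<Longrightarrow> rapid (\<lambda>x. f x - g x)"
  using rapid_add[OF _ rapid_cmult[of g "-1"]] by simp

lemma rapid_power_mult:
  assumes "rapid f" shows "rapid (\<lambda>x. x ^ n * f x)"
  unfolding rapid_def
proof
  fix k :: nat
  obtain M where M: "\<And>x. (1 + \<bar>x\<bar>) ^ (k + n) * \<bar>f x\<bar> \<le> M" using rapidE[OF assms(1)] by blast
  have "(1 + \<bar>x\<bar>) ^ k * \<bar>x ^ n * f x\<bar> \<le> M" for x
  proof -
    have "\<bar>x\<bar> ^ n \<le> (1 + \<bar>x\<bar>) ^ n" by (intro power_mono) auto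
    then have "(1 + \<bar>x\<bar>) ^ k * (\<bar>x\<bar> ^ n * \<bar>f x\<bar>) \<le> (1 + \<bar>x\<bar>) ^ k * ((1 + \<bar>x\<bar>) ^ n * \<bar>f x\<bar>)"
      by (intro mult_left_mono mult_right_mono) auto
    also have "\<dots> \<le> M" using M[of x] by (simp add: power_add mult_ac)
    finally show ?thesis by (simp add: abs_mult power_abs)
  qed
  then show "\<exists>M. \<forall>x. (1 + \<bar>x\<bar>) ^ k * \<bar>x ^ n * f x\<bar> \<le> M" by blast
qed

text \<open>Weight \<open>k\<close> for the power amounts to weight \<open>k / a\<close> for
  \<open>f\<close>, so even a small positive exponent preserves rapid decay. This is what makes
  \<open>u powr (p - 1)\<close> decay.\<close>

lemma rapid_powr:
  assumes "rapid f" "0 < a" shows "rapid (\<lambda>x. \<bar>f x\<bar> powr a)"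
  unfolding rapid_def
proof
  fix k :: nat
  obtain n :: nat where n: "real k / a \<le> n" using real_arch_simple by blast
  obtain M where M: "0 \<le> M" "\<And>x. (1 + \<bar>x\<bar>) ^ n * \<bar>f x\<bar> \<le> M" using rapidE[OF assms(1)] by blast
  have "(1 + \<bar>x\<bar>) ^ k * \<bar>\<bar>f x\<bar> powr a\<bar> \<le> M powr a" for x
  proof -
    have "(1 + \<bar>x\<bar>) ^ k = (1 + \<bar>x\<bar>) powr k" by (simp add: powr_realpow)
    also have "\<dots> \<le> (1 + \<bar>x\<bar>) powr (n * a)"
      using n assms(2) by (intro powr_mono) (auto simp: field_simps)
    also have "\<dots> = ((1 + \<bar>x\<bar>) ^ n) powr a"
      by (simp add: powr_powr[symmetric] powr_realpow)
    finally have "(1 + \<bar>x\<bar>) ^ k * \<bar>f x\<bar> powr a \<le> ((1 + \<bar>x\<bar>) ^ n) powr a * \<bar>f x\<bar> powr a"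
      by (intro mult_right_mono) auto
    also have "\<dots> = ((1 + \<bar>x\<bar>) ^ n * \<bar>f x\<bar>) powr a" by (simp add: powr_mult)
    also have "\<dots> \<le> M powr a" using M assms(2) by (intro powr_mono2) auto
    finally show ?thesis by simp
  qed
  then show "\<exists>M. \<forall>x. (1 + \<bar>x\<bar>) ^ k * \<bar>\<bar>f x\<bar> powr a\<bar> \<le> M" by blast
qed

lemma rapid_integrable:
  assumes "rapid f" "continuous_on UNIV f" shows "integrable lborel f"
proof -
  obtain M where M: "\<And>x. (1 + \<bar>x\<bar>) ^ 2 * \<bar>f x\<bar> \<le> M" using rapidE[OF assms(1)] by blast
  have "(1 + x\<^sup>2) * \<bar>f x\<bar> \<le> M" for x
  proof -
    have "1 + x\<^sup>2 \<le> (1 + \<bar>x\<bar>)\<^sup>2" by (simp add: power2_eq_square algebra_simps)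
    then show ?thesis using M[of x] by (meson abs_ge_zero mult_right_mono order_trans)
  qed
  then show ?thesis
    by (rule integrable_quadratic_decay[OF borel_measurable_continuous_onI[OF assms(2)]])
qed

lemma rapid_tendsto_0:
  assumes "rapid f" shows "(f \<longlongrightarrow> 0) at_top" "(f \<longlongrightarrow> 0) at_bot"
proof -
  obtain M where M: "\<And>x. (1 + \<bar>x\<bar>) ^ 1 * \<bar>f x\<bar> \<le> M" using rapidE[OF assms(1)] by blast
  have b: "norm (f x) \<le> M / (1 + \<bar>x\<bar>)" for x
    using M[of x] by (simp add: field_simps)
  have "((\<lambda>x::real. M / (1 + \<bar>x\<bar>)) \<longlongrightarrow> 0) at_top"
    by (intro tendsto_divide_0[OF tendsto_const] filterlim_at_top_imp_at_infinity
        filterlim_tendsto_add_at_top[OF tendsto_const] filterlim_abs_real)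
  then show "(f \<longlongrightarrow> 0) at_top" by (rule Lim_null_comparison[OF always_eventually[OF allI[OF b]]])
  have "filterlim (\<lambda>x::real. \<bar>x\<bar>) at_top at_bot"
    by (auto simp: filterlim_at_bot_mirror filterlim_abs_real)
  then have "((\<lambda>x::real. M / (1 + \<bar>x\<bar>)) \<longlongrightarrow> 0) at_bot"
    by (intro tendsto_divide_0[OF tendsto_const] filterlim_at_top_imp_at_infinity
        filterlim_tendsto_add_at_top[OF tendsto_const])
  then show "(f \<longlongrightarrow> 0) at_bot" by (rule Lim_null_comparison[OF always_eventually[OF allI[OF b]]])
qed

text \<open>The mean value theorem on \<open>[x, x + 1]\<close> bounds \<open>f' x\<close> by \<open>f x\<close>, \<open>f (x + 1)\<close> and \<open>f''\<close> on that interval.\<close>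

lemma rapid_interpolation:
  assumes f: "\<And>x. (f has_real_derivative f' x) (at x)"
    and f': "\<And>x. (f' has_real_derivative f'' x) (at x)"
    and "rapid f" "rapid f''"
  shows "rapid f'"
  unfolding rapid_def
proof
  fix k :: nat
  obtain M where M: "0 \<le> M" "\<And>x. (1 + \<bar>x\<bar>) ^ k * \<bar>f x\<bar> \<le> M" using rapidE[OF assms(3)] by blast
  obtain N where N: "0 \<le> N" "\<And>x. (1 + \<bar>x\<bar>) ^ k * \<bar>f'' x\<bar> \<le> N" using rapidE[OF assms(4)] by blast
  have "(1 + \<bar>x\<bar>) ^ k * \<bar>f' x\<bar> \<le> 2 ^ k * M + M + 2 ^ k * N" for x
  proof -
    have shift: "(1 + \<bar>x\<bar>) ^ k * \<bar>g y\<bar> \<le> 2 ^ k * K"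
      if "\<And>x. (1 + \<bar>x\<bar>) ^ k * \<bar>g x\<bar> \<le> K" "x \<le> y" "y \<le> x + 1" for g y K
    proof -
      have "(1 + \<bar>x\<bar>) ^ k \<le> (2 * (1 + \<bar>y\<bar>)) ^ k" using that by (intro power_mono) auto
      then have "(1 + \<bar>x\<bar>) ^ k * \<bar>g y\<bar> \<le> (2 * (1 + \<bar>y\<bar>)) ^ k * \<bar>g y\<bar>"
        by (intro mult_right_mono) auto
      also have "\<dots> = 2 ^ k * ((1 + \<bar>y\<bar>) ^ k * \<bar>g y\<bar>)" by (simp only: power_mult_distrib mult.assoc)
      also have "\<dots> \<le> 2 ^ k * K" by (intro mult_left_mono that) auto
      finally show ?thesis .
    qed
    obtain z where z: "x < z" "z < x + 1" "f (x + 1) - f x = (x + 1 - x) * f' z"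
      using MVT2[of x "x + 1" f f'] f by auto
    obtain y where y: "x < y" "y < z" "f' z - f' x = (z - x) * f'' y"
      using MVT2[of x z f' f''] f' z by auto
    have "\<bar>f' x\<bar> \<le> \<bar>f (x + 1)\<bar> + \<bar>f x\<bar> + \<bar>f'' y\<bar>"
    proof -
      have "\<bar>(z - x) * f'' y\<bar> \<le> 1 * \<bar>f'' y\<bar>"
        unfolding abs_mult using y z by (intro mult_right_mono) auto
      moreover have "f (x + 1) - f x = f' z" using z by simp
      ultimately show ?thesis using y by linarith
    qed
    then have "(1 + \<bar>x\<bar>) ^ k * \<bar>f' x\<bar> \<le> (1 + \<bar>x\<bar>) ^ k * (\<bar>f (x + 1)\<bar> + \<bar>f x\<bar> + \<bar>f'' y\<bar>)"
      by (intro mult_left_mono) auto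
    also have "\<dots> \<le> 2 ^ k * M + M + 2 ^ k * N"
      using shift[OF M(2), of "x + 1"] M(2)[of x] shift[OF N(2), of y] y z by (simp add: distrib_left)
    finally show ?thesis .
  qed
  then show "\<exists>M. \<forall>x. (1 + \<bar>x\<bar>) ^ k * \<bar>f' x\<bar> \<le> M" by blast
qed

section \<open>Calculus for nonnegative functions\<close>

text \<open>At a zero of \<open>f\<close> the difference quotient of the power is
  \<open>f y powr (q - 1)\<close> times that of \<open>f\<close>, and the first factor tends to 0
  because \<open>1 < q\<close>.\<close>

lemma DERIV_powr_nonneg:
  fixes f :: "real \<Rightarrow> real"
  assumes f: "(f has_real_derivative f') (at x)" and "open S" "x \<in> S"
    and nonneg: "\<And>y. y \<in> S \<Longrightarrow> 0 \<le> f y" and q: "1 < q"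
  shows "((\<lambda>y. f y powr q) has_real_derivative q * f x powr (q - 1) * f') (at x)"
proof (cases "f x = 0")
  case False
  with nonneg[OF \<open>x \<in> S\<close>] have "0 < f x" by simp
  then show ?thesis
    using DERIV_powr[OF f _ DERIV_const, of q]
    by (auto simp: powr_diff field_simps elim!: DERIV_cong)
next
  case True
  have ev: "\<forall>\<^sub>F y in at x. 0 \<le> f y"
    using eventually_at_in_open'[OF \<open>open S\<close> \<open>x \<in> S\<close>] by eventually_elim (rule nonneg)
  have lim: "(f \<longlongrightarrow> 0) (at x)"
    using DERIV_isCont[OF f] True by (simp add: isCont_def)
  have "((\<lambda>y. f y powr (q - 1) * ((f y - f x) / (y - x))) \<longlongrightarrow> 0 powr (q - 1) * f') (at x)"
    using f lim ev q unfolding has_field_derivative_iff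
    by (intro tendsto_mult tendsto_powr') auto
  moreover have "\<forall>\<^sub>F y in at x. f y powr (q - 1) * ((f y - f x) / (y - x)) = (f y powr q - f x powr q) / (y - x)"
    using ev
  proof eventually_elim
    case (elim y)
    then have "f y powr (q - 1) * f y = f y powr q"
      by (cases "f y = 0") (simp_all add: powr_diff)
    then show ?case by (simp add: True)
  qed
  ultimately have "((\<lambda>y. (f y powr q - f x powr q) / (y - x)) \<longlongrightarrow> 0 powr (q - 1) * f') (at x)"
    by (rule Lim_transform_eventually)
  then show ?thesis using True q by (simp add: has_field_derivative_iff)
qed

lemma MVT_abs:
  fixes f f' :: "real \<Rightarrow> real"
  assumes f: "\<And>y. \<bar>y - x\<bar> \<le> \<bar>h\<bar> \<Longrightarrow> (f has_real_derivative f' y) (at y)"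
  obtains z where "\<bar>z - x\<bar> \<le> \<bar>h\<bar>" "f (x + h) - f x = h * f' z"
proof (cases h "0::real" rule: linorder_cases)
  case less
  obtain z where "x + h < z" "z < x" "f x - f (x + h) = (x - (x + h)) * f' z"
    using MVT2[of "x + h" x f f'] f less by auto
  with less that[of z] show thesis by (simp add: algebra_simps)
next
  case equal
  with that[of x] show thesis by simp
next
  case greater
  obtain z where "x < z" "z < x + h" "f (x + h) - f x = (x + h - x) * f' z"
    using MVT2[of x "x + h" f f'] f greater by auto
  with greater that[of z] show thesis by simp
qed

text \<open>A nonnegative function with bounded second derivative lies below a parabola at each
  point, so the minimum of that parabola is nonnegative. Two mean value steps give the quadratic
  term \<open>M * h ^ 2\<close>, whence the constant 4.\<close>

lemma nonneg_deriv_sq_le: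
  fixes f f' f'' :: "real \<Rightarrow> real"
  assumes f: "\<And>x. (f has_real_derivative f' x) (at x)"
    and f': "\<And>x. (f' has_real_derivative f'' x) (at x)"
    and nonneg: "\<And>x. 0 \<le> f x" and M: "\<And>x. \<bar>f'' x\<bar> \<le> M" "0 < M"
  shows "(f' x)\<^sup>2 \<le> 4 * M * f x"
proof -
  \<comment> \<open>The minimiser of \<open>f x + h * f' x + M * h ^ 2\<close>.\<close>
  define h where "h = - f' x / (2 * M)"
  obtain z where z: "\<bar>z - x\<bar> \<le> \<bar>h\<bar>" "f (x + h) - f x = h * f' z"
    using MVT_abs[of x h f f'] f by blast
  obtain y where y: "f' z - f' x = (z - x) * f'' y"
    using MVT_abs[of x "z - x" f' f''] f' by auto
  have "\<bar>f' z - f' x\<bar> \<le> \<bar>h\<bar> * M"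
    unfolding y abs_mult by (intro mult_mono z M) auto
  then have "\<bar>h * (f' z - f' x)\<bar> \<le> \<bar>h\<bar> * (\<bar>h\<bar> * M)"
    unfolding abs_mult by (intro mult_left_mono) auto
  also have "\<dots> = h\<^sup>2 * M" by (simp add: power2_eq_square)
  finally have "h * (f' z - f' x) \<le> h\<^sup>2 * M" by linarith
  with z(2) nonneg[of "x + h"] have "0 \<le> f x + h * f' x + h\<^sup>2 * M"
    by (simp add: right_diff_distrib)
  also have "\<dots> = f x - (f' x)\<^sup>2 / (4 * M)"
    using M(2) by (simp add: h_def power2_eq_square field_simps)
  finally show ?thesis using M(2) by (simp add: field_simps)
qed

text \<open>
  The boundary term \<open>v' a v''\<close> need not tend to zero.  If it stayed above \<open>\<epsilon>\<close>, then \<open>(v'\<^sup>2)' > 2 \<epsilon>\<close>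
  because \<open>a \<rightarrow> 0\<close>, so \<open>\<bar>v'\<bar>\<close> would eventually exceed 1, contradicting \<open>v \<rightarrow> 0\<close>.
\<close>

lemma frequently_boundary_term_le:
  fixes v v1 v2 a :: "real \<Rightarrow> real"
  assumes v: "\<And>x. (v has_real_derivative v1 x) (at x)"
    and v1: "\<And>x. (v1 has_real_derivative v2 x) (at x)"
    and "(v \<longlongrightarrow> 0) at_top" "(a \<longlongrightarrow> 0) at_top" "\<And>x. 0 \<le> a x" "0 < \<epsilon>"
  shows "\<exists>\<^sub>F x in at_top. v1 x * (a x * v2 x) \<le> \<epsilon>"
proof (rule ccontr)
  assume "\<not> ?thesis"
  then have "\<forall>\<^sub>F x in at_top. \<epsilon> < v1 x * (a x * v2 x)"
    by (simp add: not_frequently not_le)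
  moreover have "\<forall>\<^sub>F x in at_top. \<bar>a x\<bar> < 1" "\<forall>\<^sub>F x in at_top. \<bar>v x\<bar> < 1 / 4"
    using tendstoD[OF assms(4), of 1] tendstoD[OF assms(3), of "1 / 4"] by simp_all
  ultimately have "\<forall>\<^sub>F x in at_top. \<epsilon> \<le> v1 x * v2 x \<and> \<bar>v x\<bar> < 1 / 4"
  proof eventually_elim
    case (elim x)
    have a: "0 \<le> a x" "a x \<le> 1" using elim assms(5)[of x] by auto
    have lt: "\<epsilon> < a x * (v1 x * v2 x)" using elim by (simp add: mult_ac)
    then have "0 < v1 x * v2 x"
      using mult_nonneg_nonpos[OF a(1), of "v1 x * v2 x"] \<open>0 < \<epsilon>\<close> by linarith
    then have "a x * (v1 x * v2 x) \<le> 1 * (v1 x * v2 x)"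
      using a by (intro mult_right_mono) auto
    with lt elim show ?case by simp
  qed
  then obtain R where R: "\<And>x. R \<le> x \<Longrightarrow> \<epsilon> \<le> v1 x * v2 x" "\<And>x. R \<le> x \<Longrightarrow> \<bar>v x\<bar> < 1 / 4"
    unfolding eventually_at_top_linorder by blast
  \<comment> \<open>Beyond \<open>R\<close> the square of \<open>v1\<close> grows at rate at least
    \<open>2 * \<epsilon>\<close>, so over the length \<open>1 / \<epsilon>\<close> it gains at
    least 2.\<close>
  define X where "X = R + 1 / \<epsilon>"
  have big: "1 \<le> (v1 x)\<^sup>2" if "X \<le> x" for x
  proof -
    have "R \<le> x" using that divide_pos_pos[OF zero_less_one \<open>0 < \<epsilon>\<close>] unfolding X_def by linarith
    have "(v1 R)\<^sup>2 - 2 * \<epsilon> * R \<le> (v1 x)\<^sup>2 - 2 * \<epsilon> * x"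
    proof (rule DERIV_nonneg_imp_nondecreasing[OF \<open>R \<le> x\<close>])
      fix y assume "R \<le> y" "y \<le> x"
      have "((\<lambda>x. (v1 x)\<^sup>2 - 2 * \<epsilon> * x) has_real_derivative 2 * (v1 y * v2 y) - 2 * \<epsilon>) (at y)"
        by (auto intro!: derivative_eq_intros v1)
      then show "\<exists>d. ((\<lambda>x. (v1 x)\<^sup>2 - 2 * \<epsilon> * x) has_real_derivative d) (at y) \<and> 0 \<le> d"
        using R(1)[OF \<open>R \<le> y\<close>] by (intro exI conjI) auto
    qed
    moreover have "2 \<le> 2 * \<epsilon> * (x - R)"
      using that \<open>0 < \<epsilon>\<close> by (simp add: X_def field_simps)
    ultimately show ?thesis using zero_le_power2[of "v1 R"] unfolding right_diff_distrib by linarith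
  qed
  \<comment> \<open>On a unit interval \<open>v\<close> changes by less than \<open>1 / 2\<close>,
    so \<open>v1\<close> is small somewhere on it, against \<open>big\<close>.\<close>
  obtain z where z: "X < z" "z < X + 1" "v (X + 1) - v X = (X + 1 - X) * v1 z"
    using MVT2[of X "X + 1" v v1] v by auto
  have "R \<le> X" using \<open>0 < \<epsilon>\<close> by (simp add: X_def)
  then have "\<bar>v1 z\<bar> < 1"
    using R(2)[of X] R(2)[of "X + 1"] z(3) by simp
  then have "(v1 z)\<^sup>2 < 1" by (simp add: abs_square_less_1)
  with big[of z] z(1) show False by simp
qed

text \<open>Reflection changes the sign of \<open>v1\<close> but not of \<open>v2\<close>, hence of
  the boundary term; the upper bound at \<open>at_top\<close> becomes a lower bound at
  \<open>at_bot\<close>.\<close>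

lemma frequently_boundary_term_ge:
  fixes v v1 v2 a :: "real \<Rightarrow> real"
  assumes v: "\<And>x. (v has_real_derivative v1 x) (at x)"
    and v1: "\<And>x. (v1 has_real_derivative v2 x) (at x)"
    and "(v \<longlongrightarrow> 0) at_bot" "(a \<longlongrightarrow> 0) at_bot" "\<And>x. 0 \<le> a x" "0 < \<epsilon>"
  shows "\<exists>\<^sub>F x in at_bot. - \<epsilon> \<le> v1 x * (a x * v2 x)"
proof -
  have "\<exists>\<^sub>F x in at_top. - v1 (- x) * (a (- x) * v2 (- x)) \<le> \<epsilon>"
  proof (rule frequently_boundary_term_le[where v = "\<lambda>x. v (- x)"])
    show "((\<lambda>x. v (- x)) has_real_derivative - v1 (- x)) (at x)" for x
      using v[of "- x"] by (simp add: DERIV_mirror)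
    have "((\<lambda>x. v1 (- x)) has_real_derivative - v2 (- x)) (at x)" for x
      using v1[of "- x"] by (simp add: DERIV_mirror)
    from DERIV_minus[OF this]
    show "((\<lambda>x. - v1 (- x)) has_real_derivative v2 (- x)) (at x)" for x by simp
  qed (use assms in \<open>simp_all add: filterlim_at_bot_mirror\<close>)
  then have "\<exists>\<^sub>F x in at_top. - \<epsilon> \<le> v1 (- x) * (a (- x) * v2 (- x))"
    by (rule frequently_elim1) simp
  then show ?thesis by (simp add: at_bot_mirror frequently_def eventually_filtermap)
qed

section \<open>A solution at a fixed time\<close>

text \<open>
  A solution at a fixed time: \<open>v = u powr (p - 1)\<close> has derivatives \<open>v1\<close>, \<open>v2\<close>, and the flux
  \<open>w = u powr p * v2\<close> has derivatives \<open>w1\<close>, \<open>w2\<close>.  No continuity of \<open>v2\<close> is assumed, since it may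
  fail at zeros of \<open>u\<close>.
\<close>

locale flux_profile =
  fixes p :: real and u u1 u2 v1 v2 w1 w2 :: "real \<Rightarrow> real"
  assumes p_gt: "1 < p"
    and u_nonneg: "\<And>x. 0 \<le> u x"
    and DERIV_u: "\<And>x. (u has_real_derivative u1 x) (at x)"
    and DERIV_u1: "\<And>x. (u1 has_real_derivative u2 x) (at x)"
    and rapid_u: "rapid u" and rapid_u2: "rapid u2"
    and DERIV_v: "\<And>x. ((\<lambda>y. u y powr (p - 1)) has_real_derivative v1 x) (at x)"
    and DERIV_v1: "\<And>x. (v1 has_real_derivative v2 x) (at x)"
    and DERIV_w: "\<And>x. ((\<lambda>y. u y powr p * v2 y) has_real_derivative w1 x) (at x)"
    and DERIV_w1: "\<And>x. (w1 has_real_derivative w2 x) (at x)"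
    and rapid_w2: "rapid w2" and cont_w2: "continuous_on UNIV w2"
begin

lemma continuous_u: "continuous_on UNIV u"
  and continuous_v1: "continuous_on UNIV v1"
  and continuous_w: "continuous_on UNIV (\<lambda>x. u x powr p * v2 x)"
  by (auto intro!: continuous_at_imp_continuous_on DERIV_isCont DERIV_u DERIV_v1 DERIV_w)

lemma continuous_u_powr: "0 < a \<Longrightarrow> continuous_on UNIV (\<lambda>x. u x powr a)"
  by (intro continuous_on_powr' continuous_u continuous_on_const) (use u_nonneg in auto)

lemma rapid_u_powr: "0 < a \<Longrightarrow> rapid (\<lambda>x. u x powr a)"
  using rapid_powr[OF rapid_u, of a] u_nonneg by simp

lemma v1_pos:
  assumes "0 < u x" shows "v1 x = (p - 1) * u x powr (p - 2) * u1 x"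
proof -
  have "((\<lambda>y. u y powr (p - 1)) has_real_derivative (p - 1) * u x powr (p - 2) * u1 x) (at x)"
    using DERIV_powr[OF DERIV_u assms DERIV_const, of "p - 1"] assms
    by (auto simp: powr_diff field_simps power2_eq_square elim!: DERIV_cong)
  then show ?thesis by (rule DERIV_unique[OF DERIV_v])
qed

lemma v2_pos:
  assumes "0 < u x"
  shows "v2 x = (p - 1) * ((p - 2) * u x powr (p - 3) * (u1 x)\<^sup>2 + u x powr (p - 2) * u2 x)"
proof -
  have "((\<lambda>y. (p - 1) * u y powr (p - 2) * u1 y) has_real_derivative
      (p - 1) * ((p - 2) * u x powr (p - 3) * (u1 x)\<^sup>2 + u x powr (p - 2) * u2 x)) (at x)"
    using DERIV_mult[OF DERIV_cmult[OF DERIV_powr[OF DERIV_u assms DERIV_const], of "p - 1" "p - 2"] DERIV_u1] assms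
    by (auto simp: powr_diff field_simps power2_eq_square power3_eq_cube elim!: DERIV_cong)
  \<comment> \<open>Positivity is an open condition, so the formula for \<open>v1\<close> holds near
    \<open>x\<close> and may be differentiated there.\<close>
  moreover have "\<forall>\<^sub>F y in nhds x. 0 < u y"
    using order_tendstoD(1)[OF DERIV_isCont[OF DERIV_u, unfolded isCont_def] assms] assms
    by (simp add: eventually_nhds_conv_at)
  then have "\<forall>\<^sub>F y in nhds x. v1 y = (p - 1) * u y powr (p - 2) * u1 y"
    by eventually_elim (rule v1_pos)
  ultimately have "(v1 has_real_derivative
      (p - 1) * ((p - 2) * u x powr (p - 3) * (u1 x)\<^sup>2 + u x powr (p - 2) * u2 x)) (at x)"
    by (subst DERIV_cong_ev[OF refl _ refl])
  then show ?thesis by (rule DERIV_unique[OF DERIV_v1])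
qed

text \<open>The factor \<open>u\<close> cancels the singular power \<open>u powr (p - 2)\<close>, so
  the identity survives at zeros of \<open>u\<close>, where both sides are 0.\<close>

lemma u_v1: "u x * v1 x = (p - 1) * u x powr (p - 1) * u1 x"
proof (cases "u x = 0")
  case False
  then have "0 < u x" using u_nonneg[of x] by simp
  then show ?thesis by (simp add: v1_pos powr_diff power2_eq_square field_simps)
qed simp

lemma u1_sq_le: obtains M where "0 < M" "\<And>x. \<bar>u2 x\<bar> \<le> M" "\<And>x. (u1 x)\<^sup>2 \<le> 4 * M * u x"
proof -
  obtain N where N: "0 \<le> N" "\<And>x. \<bar>u2 x\<bar> \<le> N" using rapid_bounded[OF rapid_u2] by blast
  have "\<bar>u2 x\<bar> \<le> N + 1" for x using N(2)[of x] by linarith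
  with N(1) nonneg_deriv_sq_le[OF DERIV_u DERIV_u1 u_nonneg, of "N + 1"] that[of "N + 1"]
  show thesis by (metis add_nonneg_pos zero_less_one)
qed

text \<open>
  The singular term \<open>u powr (2 * p - 3) * u1\<^sup>2\<close> of the flux is tamed by \<open>u1\<^sup>2 \<le> 4 M u\<close>.
\<close>

lemma rapid_w: "rapid (\<lambda>x. u x powr p * v2 x)"
proof -
  obtain M where M: "0 < M" "\<And>x. \<bar>u2 x\<bar> \<le> M" "\<And>x. (u1 x)\<^sup>2 \<le> 4 * M * u x"
    using u1_sq_le by blast
  \<comment> \<open>Replacing \<open>u1\<close> squared by \<open>4 * M * u\<close> raises the
    exponent \<open>2 * p - 3\<close> to the positive \<open>2 * p - 2\<close>. At zeros of
    \<open>u\<close> both sides are 0 whatever \<open>v2\<close> is, since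
    \<open>0 powr a = 0\<close>.\<close>
  have "\<bar>u x powr p * v2 x\<bar> \<le> (p - 1) * (4 * \<bar>p - 2\<bar> + 1) * M * \<bar>u x powr (2 * p - 2)\<bar>" for x
  proof (cases "u x = 0")
    case False
    then have pos: "0 < u x" using u_nonneg[of x] by simp
    have eq: "u x powr p * v2 x = (p - 1) * ((p - 2) * u x powr (2 * p - 3) * (u1 x)\<^sup>2 + u x powr (2 * p - 2) * u2 x)"
    proof -
      have "u x powr p * u x powr (p - 3) = u x powr (2 * p - 3)"
        "u x powr p * u x powr (p - 2) = u x powr (2 * p - 2)"
        by (simp_all add: powr_add[symmetric])
      moreover have "e * ((p - 1) * ((p - 2) * a * b + c * d)) = (p - 1) * ((p - 2) * (e * a) * b + (e * c) * d)"
        for a b c d e :: real by (simp add: algebra_simps)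
      ultimately show ?thesis unfolding v2_pos[OF pos] by (simp only:)
    qed
    have "\<bar>(p - 2) * u x powr (2 * p - 3) * (u1 x)\<^sup>2\<bar> \<le> \<bar>p - 2\<bar> * (4 * M * u x powr (2 * p - 2))"
    proof -
      have "u x powr (2 * p - 3) * (u1 x)\<^sup>2 \<le> u x powr (2 * p - 3) * (4 * M * u x)"
        by (intro mult_left_mono M) auto
      also have "\<dots> = 4 * M * (u x powr (2 * p - 3) * u x powr 1)" using pos by simp
      also have "\<dots> = 4 * M * u x powr (2 * p - 2)" by (simp only: powr_add[symmetric]) simp
      finally have "\<bar>p - 2\<bar> * (u x powr (2 * p - 3) * (u1 x)\<^sup>2) \<le> \<bar>p - 2\<bar> * (4 * M * u x powr (2 * p - 2))"
        by (intro mult_left_mono) auto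
      then show ?thesis by (simp add: abs_mult mult.assoc)
    qed
    moreover have "\<bar>u x powr (2 * p - 2) * u2 x\<bar> \<le> u x powr (2 * p - 2) * M"
      unfolding abs_mult by (intro mult_mono M) auto
    ultimately have "\<bar>(p - 2) * u x powr (2 * p - 3) * (u1 x)\<^sup>2 + u x powr (2 * p - 2) * u2 x\<bar>
        \<le> \<bar>p - 2\<bar> * (4 * M * u x powr (2 * p - 2)) + u x powr (2 * p - 2) * M"
      by linarith
    then have "\<bar>u x powr p * v2 x\<bar> \<le> (p - 1) * (\<bar>p - 2\<bar> * (4 * M * u x powr (2 * p - 2)) + u x powr (2 * p - 2) * M)"
      unfolding eq abs_mult[of "p - 1"] using p_gt by (simp only: abs_of_pos) (intro mult_left_mono, auto)
    then show ?thesis by (simp add: algebra_simps)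
  qed simp
  then show ?thesis using p_gt by (intro rapid_mono[OF rapid_u_powr[of "2 * p - 2"]]) auto
qed

text \<open>Decay of the first derivative of the flux is interpolated between that of the flux and
  that of \<open>w2\<close>; in the application \<open>w2\<close> is a multiple of the time
  derivative of \<open>u\<close>.\<close>

lemma rapid_w1: "rapid w1"
  by (rule rapid_interpolation[OF DERIV_w DERIV_w1 rapid_w rapid_w2])

lemma rapid_u1: "rapid u1"
  by (rule rapid_interpolation[OF DERIV_u DERIV_u1 rapid_u rapid_u2])

text \<open>\<open>v1\<close> alone need not decay. On the positive set the product is
  \<open>(p - 1)\<close> squared times \<open>u powr (2 * p - 3)\<close> times \<open>u1\<close>
  squared, and \<open>u1_sq_le\<close> removes the possibly negative exponent.\<close>

lemma rapid_u_v1_sq: "rapid (\<lambda>x. u x * (v1 x)\<^sup>2)"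
proof -
  obtain M where M: "0 < M" "\<And>x. (u1 x)\<^sup>2 \<le> 4 * M * u x"
    using u1_sq_le by metis
  have "\<bar>u x * (v1 x)\<^sup>2\<bar> \<le> (p - 1)\<^sup>2 * (4 * M) * \<bar>u x powr (2 * p - 2)\<bar>" for x
  proof (cases "u x = 0")
    case False
    then have pos: "0 < u x" using u_nonneg[of x] by simp
    have "u x * (u x powr (p - 2))\<^sup>2 * u x = u x powr 1 * (u x powr (p - 2))\<^sup>2 * u x powr 1"
      using pos by simp
    also have "\<dots> = u x powr (2 * p - 2)"
      by (simp only: power2_eq_square powr_add[symmetric]) (simp add: algebra_simps)
    finally have *: "u x * (u x powr (p - 2))\<^sup>2 * u x = u x powr (2 * p - 2)" .
    have "u x * (v1 x)\<^sup>2 = (p - 1)\<^sup>2 * (u x * (u x powr (p - 2))\<^sup>2) * (u1 x)\<^sup>2"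
      by (simp add: v1_pos[OF pos] power_mult_distrib mult_ac)
    also have "\<dots> \<le> (p - 1)\<^sup>2 * (u x * (u x powr (p - 2))\<^sup>2) * (4 * M * u x)"
      using pos by (intro mult_left_mono M) auto
    also have "\<dots> = (p - 1)\<^sup>2 * (4 * M) * (u x * (u x powr (p - 2))\<^sup>2 * u x)" by (simp only: mult_ac)
    finally show ?thesis unfolding * using pos by simp
  qed simp
  then show ?thesis using p_gt by (intro rapid_mono[OF rapid_u_powr[of "2 * p - 2"]]) auto
qed

section \<open>Integral identities for the flux\<close>

lemma DERIV_u_powr: "((\<lambda>y. u y powr p) has_real_derivative p / (p - 1) * (u x * v1 x)) (at x)"
proof -
  have "p / (p - 1) * (u x * v1 x) = p * u x powr (p - 1) * u1 x"
    using p_gt by (simp add: u_v1)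
  then show ?thesis
    using DERIV_powr_nonneg[OF DERIV_u open_UNIV UNIV_I u_nonneg p_gt] by simp
qed

text \<open>One integration by parts: by \<open>DERIV_u_powr\<close> the derivative of
  \<open>u powr p\<close> is a multiple of \<open>u * v1\<close>. The boundary term
  \<open>u powr p * v1\<close> decays because it equals
  \<open>(p - 1) * u powr (2 * p - 2) * u1\<close>.\<close>

lemma integral_w: "(LINT x|lborel. u x powr p * v2 x) = - (p / (p - 1)) * (LINT x|lborel. u x * (v1 x)\<^sup>2)"
proof -
  let ?F = "\<lambda>x. u x powr p * v1 x"
  have eq: "u x powr p * v1 x = (p - 1) * (u x powr (2 * p - 2) * u1 x)" for x
  proof -
    have "u x powr p * v1 x = u x powr (p - 1) * (u x * v1 x)"
      using u_nonneg[of x] by (cases "u x = 0") (simp_all add: powr_diff)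
    also have "\<dots> = (p - 1) * (u x powr (p - 1) * u x powr (p - 1) * u1 x)"
      by (simp add: u_v1)
    finally show ?thesis by (simp add: powr_add[symmetric])
  qed
  have "rapid ?F"
    unfolding eq using p_gt by (intro rapid_cmult rapid_mult rapid_u_powr rapid_u1) auto
  then have lim: "(?F \<longlongrightarrow> 0) at_bot" "(?F \<longlongrightarrow> 0) at_top" by (auto intro: rapid_tendsto_0)
  let ?a = "\<lambda>x. u x * (v1 x)\<^sup>2" and ?b = "\<lambda>x. u x powr p * v2 x"
  have cont: "continuous_on UNIV ?a" by (intro continuous_intros continuous_u continuous_v1)
  have int: "integrable lborel ?a" "integrable lborel ?b"
    by (intro rapid_integrable rapid_u_v1_sq rapid_w continuous_w cont)+
  have "(LINT x|lborel. p / (p - 1) * ?a x + ?b x) = 0 - 0"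
  proof (rule integral_FTC_line[OF _ _ _ lim])
    show "(?F has_real_derivative p / (p - 1) * ?a x + ?b x) (at x)" for x
      using DERIV_mult[OF DERIV_u_powr DERIV_v1, of x]
      by (auto simp: power2_eq_square mult_ac elim!: DERIV_cong)
  qed (intro continuous_on_add continuous_on_mult_left cont continuous_w
      Bochner_Integration.integrable_add integrable_mult_right int)+
  then show ?thesis using int by simp
qed

lemma integral_w2: "(LINT x|lborel. w2 x) = 0"
  using integral_FTC_line[OF cont_w2 rapid_integrable[OF rapid_w2 cont_w2] DERIV_w1
      rapid_tendsto_0(2)[OF rapid_w1] rapid_tendsto_0(1)[OF rapid_w1]] by simp

text \<open>Two integrations by parts move both derivatives from the flux to the square of
  \<open>x\<close>; \<open>?F\<close> gathers the two boundary terms.\<close>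

lemma integral_sq_w2: "(LINT x|lborel. x\<^sup>2 * w2 x) = 2 * (LINT x|lborel. u x powr p * v2 x)"
proof -
  let ?w = "\<lambda>x. u x powr p * v2 x"
  let ?F = "\<lambda>x. x ^ 2 * w1 x - 2 * (x ^ 1 * ?w x)"
  have "rapid ?F"
    by (intro rapid_diff rapid_cmult rapid_power_mult rapid_w rapid_w1)
  then have lim: "(?F \<longlongrightarrow> 0) at_bot" "(?F \<longlongrightarrow> 0) at_top" by (auto intro: rapid_tendsto_0)
  have int: "integrable lborel (\<lambda>x. x\<^sup>2 * w2 x)" "integrable lborel ?w"
    by (auto intro!: rapid_integrable rapid_power_mult rapid_w2 rapid_w continuous_w continuous_intros cont_w2)
  have "(LINT x|lborel. x\<^sup>2 * w2 x - 2 * ?w x) = 0 - 0"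
  proof (rule integral_FTC_line[OF _ _ _ lim])
    show "(?F has_real_derivative x\<^sup>2 * w2 x - 2 * ?w x) (at x)" for x
      by (rule derivative_eq_intros DERIV_w DERIV_w1 refl | simp)+
  qed (auto intro!: continuous_intros continuous_w cont_w2 int)
  then show ?thesis using int by simp
qed

text \<open>
  Integrating by parts would give \<open>\<integral> v w2 = \<integral> u powr p * v2\<^sup>2\<close>, but the right integrand may be
  discontinuous and the boundary terms need not vanish.  Using only
  \<open>u powr p * (v2 - c)\<^sup>2 \<ge> 0\<close> avoids integrating it; \<open>c = \<integral> w / \<integral> u powr p\<close> is the
  optimal choice and replaces the Cauchy-Schwarz inequality.
\<close>

lemma entropy_dissipation_linear:
  "2 * c * (LINT x|lborel. u x powr p * v2 x) - c\<^sup>2 * (LINT x|lborel. u x powr p)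
    \<le> (LINT x|lborel. u x powr (p - 1) * w2 x)"
proof -
  let ?v = "\<lambda>x. u x powr (p - 1)" and ?w = "\<lambda>x. u x powr p * v2 x"
  define h where "h = (\<lambda>x. ?v x * w2 x - 2 * c * ?w x + c\<^sup>2 * u x powr p)"
  have pp: "0 < p - 1" "0 < p" using p_gt by auto
  have "rapid h"
    unfolding h_def by (intro rapid_add rapid_diff rapid_cmult rapid_mult rapid_u_powr rapid_w rapid_w2 pp)
  moreover have "continuous_on UNIV h"
    unfolding h_def by (intro continuous_intros continuous_u_powr continuous_w cont_w2 pp)
  ultimately obtain P where P: "\<And>x. (P has_real_derivative h x) (at x)"
    "(P \<longlongrightarrow> 0) at_bot" "(P \<longlongrightarrow> (LINT x|lborel. h x)) at_top"
    using integrable_imp_primitive rapid_integrable by metis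
  \<comment> \<open>The derivative of \<open>v * w1 - v1 * w\<close> is
    \<open>v * w2 - v2 * w\<close>. Subtracting it from \<open>h\<close> trades
    \<open>v * w2\<close> for \<open>u powr p\<close> times \<open>v2\<close> squared and completes
    the square.\<close>
  define Q where "Q = (\<lambda>x. P x - (?v x * w1 x - v1 x * ?w x))"
  have Q_mono: "Q a \<le> Q b" if "a \<le> b" for a b
  proof (rule DERIV_nonneg_imp_nondecreasing[OF that])
    fix x
    have "(Q has_real_derivative u x powr p * (v2 x - c)\<^sup>2) (at x)"
      unfolding Q_def
      by (rule derivative_eq_intros P DERIV_v DERIV_v1 DERIV_w DERIV_w1 refl)+
        (simp add: h_def power2_eq_square algebra_simps)
    then show "\<exists>d. (Q has_real_derivative d) (at x) \<and> 0 \<le> d"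
      by (intro exI conjI) auto
  qed
  have vw: "rapid (\<lambda>x. ?v x * w1 x)" by (intro rapid_mult rapid_u_powr rapid_w1 pp)
  have "0 \<le> (LINT x|lborel. h x)"
  proof (rule ccontr)
    assume neg: "\<not> ?thesis"
    \<comment> \<open>Each end costs three errors of size \<open>e\<close>: \<open>Q b\<close> is at
      most \<open>- 8 * e + 3 * e\<close>, while \<open>Q a\<close> is at least
      \<open>- 3 * e\<close>, which contradicts monotonicity.\<close>
    define e where "e = - (LINT x|lborel. h x) / 8"
    with neg have e: "0 < e" by simp
    have "\<forall>\<^sub>F x in at_top. \<bar>P x + 8 * e\<bar> < e" "\<forall>\<^sub>F x in at_top. \<bar>?v x * w1 x\<bar> < e"
      using tendstoD[OF P(3) e] tendstoD[OF rapid_tendsto_0(1)[OF vw] e] by (simp_all add: dist_real_def e_def)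
    moreover have "\<exists>\<^sub>F x in at_top. v1 x * ?w x \<le> e"
      by (rule frequently_boundary_term_le[OF DERIV_v DERIV_v1])
        (auto intro!: rapid_tendsto_0 rapid_u_powr pp e)
    ultimately have "\<exists>\<^sub>F x in at_top. v1 x * ?w x \<le> e \<and>
        \<bar>P x + 8 * e\<bar> < e \<and> \<bar>?v x * w1 x\<bar> < e \<and> 0 \<le> x"
      by (intro frequently_eventually_frequently eventually_conj eventually_ge_at_top)
    then obtain b where "v1 b * ?w b \<le> e" "\<bar>P b + 8 * e\<bar> < e" "\<bar>?v b * w1 b\<bar> < e" and b0: "0 \<le> b"
      using frequently_ex by blast
    then have b: "Q b \<le> - 5 * e" unfolding Q_def by linarith
    have "\<forall>\<^sub>F x in at_bot. \<bar>P x\<bar> < e" "\<forall>\<^sub>F x in at_bot. \<bar>?v x * w1 x\<bar> < e"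
      using tendstoD[OF P(2) e] tendstoD[OF rapid_tendsto_0(2)[OF vw] e] by simp_all
    moreover have "\<exists>\<^sub>F x in at_bot. - e \<le> v1 x * ?w x"
      by (rule frequently_boundary_term_ge[OF DERIV_v DERIV_v1])
        (auto intro!: rapid_tendsto_0 rapid_u_powr pp e)
    ultimately have "\<exists>\<^sub>F x in at_bot. - e \<le> v1 x * ?w x \<and>
        \<bar>P x\<bar> < e \<and> \<bar>?v x * w1 x\<bar> < e \<and> x \<le> 0"
      by (intro frequently_eventually_frequently eventually_conj eventually_le_at_bot)
    then obtain a where "- e \<le> v1 a * ?w a" "\<bar>P a\<bar> < e" "\<bar>?v a * w1 a\<bar> < e" and a0: "a \<le> 0"
      using frequently_ex by blast
    then have a: "- 3 * e \<le> Q a" unfolding Q_def by linarith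
    have "Q a \<le> Q b" by (rule Q_mono) (use a0 b0 in simp)
    with a b e show False by simp
  qed
  moreover have "(LINT x|lborel. h x) = (LINT x|lborel. ?v x * w2 x) - 2 * c * (LINT x|lborel. ?w x) + c\<^sup>2 * (LINT x|lborel. u x powr p)"
  proof -
    have "integrable lborel (\<lambda>x. ?v x * w2 x)" "integrable lborel ?w" "integrable lborel (\<lambda>x. u x powr p)"
      by (auto intro!: rapid_integrable rapid_mult rapid_u_powr rapid_w rapid_w2 continuous_intros continuous_u_powr continuous_w cont_w2 pp)
    then show ?thesis unfolding h_def by simp
  qed
  ultimately show ?thesis by simp
qed

lemma entropy_dissipation:
  assumes "0 < (LINT x|lborel. u x powr p)"
  shows "(LINT x|lborel. u x powr p * v2 x)\<^sup>2 / (LINT x|lborel. u x powr p)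
    \<le> (LINT x|lborel. u x powr (p - 1) * w2 x)"
  using entropy_dissipation_linear[of "(LINT x|lborel. u x powr p * v2 x) / (LINT x|lborel. u x powr p)"] assms
  by (simp add: power2_eq_square field_simps)

end

section \<open>Monotone transport on the line\<close>

text \<open>Start from the last zero of \<open>F\<close> before \<open>y\<close>, where
  \<open>D\<close> equals \<open>l\<close>; from there on \<open>F\<close> is positive and
  \<open>D\<close> increases. Without a zero, \<open>D\<close> increases on the whole half-line.
  This serves functions built from the transport map, which is differentiable only where mass has
  accumulated.\<close>

lemma left_limit_le_of_deriv_nonneg:
  fixes D F :: "real \<Rightarrow> real"
  assumes "continuous_on UNIV F" "continuous_on UNIV D" "(D \<longlongrightarrow> l) at_bot"
    and F: "\<And>x. 0 \<le> F x" "\<And>x. F x = 0 \<Longrightarrow> D x = l"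
    and D: "\<And>x. x < y \<Longrightarrow> 0 < F x \<Longrightarrow> \<exists>d. (D has_real_derivative d) (at x) \<and> 0 \<le> d"
  shows "l \<le> D y"
proof (cases "\<exists>x<y. F x = 0")
  case False
  then have pos: "0 < F x" if "x < y" for x using False that F(1)[of x] by (auto simp: less_le)
  have "D x \<le> D y" if "x \<le> y" for x
    by (rule DERIV_nonneg_imp_increasing_open[OF that D])
      (auto intro: pos continuous_on_subset[OF assms(2)])
  then show ?thesis
    by (intro tendsto_upperbound[OF assms(3)] eventually_mono[OF eventually_le_at_bot[of y]]) auto
next
  case True
  then obtain x where x: "x < y" "F x = 0" by blast
  have "closed (F -` {0})"
    using assms(1) by (intro closed_vimage) auto
  then have "compact ({x..y} \<inter> F -` {0})" by (intro compact_Int_closed) auto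
  moreover have "{x..y} \<inter> F -` {0} \<noteq> {}" using x by force
  ultimately obtain m where "m \<in> {x..y} \<inter> F -` {0}" "\<forall>z\<in>{x..y} \<inter> F -` {0}. z \<le> m"
    using compact_attains_sup by blast
  then have m: "m \<in> {x..y}" "F m = 0" "\<And>z. z \<in> {x..y} \<Longrightarrow> F z = 0 \<Longrightarrow> z \<le> m" by auto
  have "D m \<le> D y"
  proof (rule DERIV_nonneg_imp_increasing_open[where f = D])
    fix z assume z: "m < z" "z < y"
    then have "F z \<noteq> 0" using m(1) m(3)[of z] by auto
    then have "0 < F z" using F(1)[of z] by simp
    with z(2) show "\<exists>d. (D has_real_derivative d) (at z) \<and> 0 \<le> d" by (rule D)
  qed (use m in \<open>auto intro: continuous_on_subset[OF assms(2)]\<close>)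
  with F(2)[OF m(2)] show ?thesis by simp
qed

lemma le_right_limit_of_deriv_nonneg:
  fixes D F :: "real \<Rightarrow> real"
  assumes "continuous_on UNIV F" "continuous_on UNIV D" "(D \<longlongrightarrow> l) at_top"
    and F: "\<And>x. F x \<le> 1" "\<And>x. F x = 1 \<Longrightarrow> D x = l"
    and D: "\<And>x. y < x \<Longrightarrow> F x < 1 \<Longrightarrow> \<exists>d. (D has_real_derivative d) (at x) \<and> 0 \<le> d"
  shows "D y \<le> l"
proof -
  have "- l \<le> - D (- (- y))"
  proof (rule left_limit_le_of_deriv_nonneg[where F = "\<lambda>x. 1 - F (- x)" and D = "\<lambda>x. - D (- x)"])
    have *: "continuous_on UNIV (\<lambda>x. h (- x))" if "continuous_on UNIV h" for h :: "real \<Rightarrow> real"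
      using that by (rule continuous_on_compose2) (auto intro: continuous_intros)
    show "continuous_on UNIV (\<lambda>x. 1 - F (- x))" "continuous_on UNIV (\<lambda>x. - D (- x))"
      using *[OF assms(1)] *[OF assms(2)] by (auto intro: continuous_intros)
    show "((\<lambda>x. - D (- x)) \<longlongrightarrow> - l) at_bot"
      using assms(3) by (auto simp: filterlim_at_bot_mirror intro: tendsto_minus)
    show "\<exists>d. ((\<lambda>x. - D (- x)) has_real_derivative d) (at x) \<and> 0 \<le> d"
      if "x < - y" "0 < 1 - F (- x)" for x
    proof -
      obtain d where d: "(D has_real_derivative d) (at (- x))" "0 \<le> d" using D[of "- x"] \<open>x < - y\<close> \<open>0 < 1 - F (- x)\<close> by auto
      from d(1) have "((\<lambda>x. D (- x)) has_real_derivative - d) (at x)" by (simp add: DERIV_mirror)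
      from DERIV_minus[OF this] d(2) show ?thesis by auto
    qed
  qed (use F in auto)
  then show ?thesis by simp
qed

section \<open>Primitives of nonnegative or partly vanishing functions\<close>

lemma primitive_bounds:
  fixes F f :: "real \<Rightarrow> real"
  assumes F: "\<And>x. (F has_real_derivative f x) (at x)" and "\<And>x. 0 \<le> f x"
    and "(F \<longlongrightarrow> l) at_bot" "(F \<longlongrightarrow> m) at_top"
  shows "mono F" "l \<le> F x" "F x \<le> m"
proof -
  show mono: "mono F"
    using assms(1,2) by (intro monoI DERIV_nonneg_imp_nondecreasing[of _ _ F]) blast+
  show "l \<le> F x"
    by (intro tendsto_upperbound[OF assms(3)] eventually_mono[OF eventually_le_at_bot[of x]])
      (auto intro: monoD[OF mono])
  show "F x \<le> m"
    by (intro tendsto_lowerbound[OF assms(4)] eventually_mono[OF eventually_ge_at_top[of x]])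
      (auto intro: monoD[OF mono])
qed

lemma primitive_left_zero:
  fixes F f :: "real \<Rightarrow> real"
  assumes F: "\<And>x. (F has_real_derivative f x) (at x)" and "(F \<longlongrightarrow> l) at_bot"
    and zero: "\<And>y. y \<le> x \<Longrightarrow> f y = 0"
  shows "F x = l"
proof -
  have "F y = F x" if "y \<le> x" for y
  proof (cases "y = x")
    case False
    have "F x = F y"
    proof (rule DERIV_isconst_end[where f = F])
      show "(F has_real_derivative 0) (at z)" if "z < x" for z using F[of z] zero[of z] that by simp
      show "continuous_on {y..x} F" by (intro continuous_at_imp_continuous_on ballI DERIV_isCont[OF F])
    qed (use that False in auto)
    then show ?thesis by simp
  qed simp
  then have "((\<lambda>_::real. F x) \<longlongrightarrow> l) at_bot"
    by (intro Lim_transform_eventually[OF assms(2)] eventually_mono[OF eventually_le_at_bot[of x]])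
  then show ?thesis by (simp add: tendsto_const_iff)
qed

lemma primitive_right_zero:
  fixes F f :: "real \<Rightarrow> real"
  assumes F: "\<And>x. (F has_real_derivative f x) (at x)" and "(F \<longlongrightarrow> m) at_top"
    and zero: "\<And>y. x \<le> y \<Longrightarrow> f y = 0"
  shows "F x = m"
proof -
  have "F (- (- x)) = m"
  proof (rule primitive_left_zero[where F = "\<lambda>x. F (- x)" and f = "\<lambda>x. - f (- x)"])
    show "((\<lambda>x. F (- x)) has_real_derivative - f (- x)) (at x)" for x
      using F[of "- x"] by (simp add: DERIV_mirror)
  qed (use assms in \<open>auto simp: filterlim_at_bot_mirror\<close>)
  then show ?thesis by simp
qed

text \<open>
  \<open>F\<close> is the distribution function of \<open>f\<close>, and \<open>S\<close> the monotone map pushing \<open>f\<close> forward to a density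
  \<open>g\<close> supported on \<open>[-a, a]\<close>.  Where \<open>F\<close> is 0 or 1 it is extended by \<open>-a\<close> and \<open>a\<close>.
\<close>

locale transport =
  fixes f F g S :: "real \<Rightarrow> real" and a :: real
  assumes f_nonneg: "\<And>x. 0 \<le> f x"
    and DERIV_F: "\<And>x. (F has_real_derivative f x) (at x)"
    and F_bot: "(F \<longlongrightarrow> 0) at_bot" and F_top: "(F \<longlongrightarrow> 1) at_top"
    and cont_S: "continuous_on UNIV S"
    and S_le: "\<And>x. \<bar>S x\<bar> \<le> a"
    and S_bot: "(S \<longlongrightarrow> - a) at_bot" and S_top: "(S \<longlongrightarrow> a) at_top"
    and S_0: "\<And>x. F x = 0 \<Longrightarrow> S x = - a" and S_1: "\<And>x. F x = 1 \<Longrightarrow> S x = a"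
    and S_less: "\<And>x. 0 < F x \<Longrightarrow> F x < 1 \<Longrightarrow> \<bar>S x\<bar> < a"
    and DERIV_S: "\<And>x. 0 < F x \<Longrightarrow> F x < 1 \<Longrightarrow> (S has_real_derivative f x / g (S x)) (at x)"

text \<open>The map is the quantile function of \<open>g\<close> composed with \<open>F\<close>. The
  distribution function \<open>G\<close> of \<open>g\<close> is inverted on the compact interval
  \<open>{-a..a}\<close> only, which makes the inverse continuous up to the endpoints; its
  derivative is taken only inside, since \<open>g\<close> vanishes at the endpoints.\<close>

lemma transport_exists:
  fixes f F g :: "real \<Rightarrow> real"
  assumes f: "\<And>x. 0 \<le> f x"
    and F: "\<And>x. (F has_real_derivative f x) (at x)" "(F \<longlongrightarrow> 0) at_bot" "(F \<longlongrightarrow> 1) at_top"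
    and a: "0 < a"
    and g: "continuous_on UNIV g" "integrable lborel g" "(LINT x|lborel. g x) = 1"
      "\<And>y. \<bar>y\<bar> < a \<Longrightarrow> 0 < g y" "\<And>y. a \<le> \<bar>y\<bar> \<Longrightarrow> g y = 0"
  obtains S where "transport f F g S a"
proof -
  obtain G where G: "\<And>x. (G has_real_derivative g x) (at x)" "(G \<longlongrightarrow> 0) at_bot" "(G \<longlongrightarrow> 1) at_top"
    using integrable_imp_primitive[OF g(1,2)] g(3) by metis
  have contG: "continuous_on A G" for A by (intro continuous_at_imp_continuous_on ballI DERIV_isCont[OF G(1)])
  have contF: "continuous_on A F" for A by (intro continuous_at_imp_continuous_on ballI DERIV_isCont[OF F(1)])
  have F01: "0 \<le> F x" "F x \<le> 1" for x using primitive_bounds[OF F(1) f F(2,3)] by auto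
  have Ga: "G (- a) = 0" "G a = 1"
    using a by (auto intro!: primitive_left_zero[OF G(1,2)] primitive_right_zero[OF G(1,3)] g(5))
  have less: "G x < G y" if "x < y" "- a \<le> x" "y \<le> a" for x y
  proof (rule DERIV_pos_imp_increasing_open[OF that(1) _ contG])
    fix z assume "x < z" "z < y"
    then show "\<exists>d. (G has_real_derivative d) (at z) \<and> 0 < d"
      using that by (intro exI[of _ "g z"] conjI G(1) g(4)) auto
  qed
  have inj: "inj_on G {-a..a}"
    by (intro strict_mono_on_imp_inj_on strict_mono_onI less) auto
  have img: "G ` {-a..a} = {0..1}"
  proof
    show "G ` {-a..a} \<subseteq> {0..1}"
      using less[of _ a] less[of "-a"] Ga by (force simp: le_less)
    show "{0..1} \<subseteq> G ` {-a..a}"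
    proof
      fix y :: real assume "y \<in> {0..1}"
      then show "y \<in> G ` {-a..a}" using IVT'[of G "-a" y a] Ga contG a by auto
    qed
  qed
  define I where "I = the_inv_into {-a..a} G"
  have contI: "continuous_on {0..1} I"
    using continuous_on_inv_into[OF contG compact_Icc inj] img by (simp add: I_def)
  have GI: "G (I y) = y" "I y \<in> {-a..a}" if "y \<in> {0..1}" for y
    using that img f_the_inv_into_f[OF inj] the_inv_into_into[OF inj _ order_refl] by (auto simp: I_def)
  have IG: "I (G x) = x" if "x \<in> {-a..a}" for x
    using the_inv_into_f_f[OF inj that] by (simp add: I_def)
  have I01: "I 0 = - a" "I 1 = a" using IG[of "- a"] IG[of a] Ga a by auto
  have I_less: "\<bar>I y\<bar> < a" if "0 < y" "y < 1" for y
  proof -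
    have "I y \<noteq> - a" "I y \<noteq> a" using GI(1)[of y] Ga that by auto
    with GI(2)[of y] that show ?thesis by (auto simp: abs_less_iff)
  qed
  define S where "S = (\<lambda>x. I (F x))"
  have "transport f F g S a"
  proof
    show "continuous_on UNIV S"
      unfolding S_def by (rule continuous_on_compose2[OF contI contF]) (use F01 in auto)
    show "\<bar>S x\<bar> \<le> a" for x using GI(2)[of "F x"] F01[of x] by (auto simp: S_def)
    show "(S \<longlongrightarrow> - a) at_bot" "(S \<longlongrightarrow> a) at_top"
      using continuous_on_tendsto_compose[OF contI F(2)] continuous_on_tendsto_compose[OF contI F(3)] F01
      by (auto simp: S_def I01)
    show "F x = 0 \<Longrightarrow> S x = - a" "F x = 1 \<Longrightarrow> S x = a" for x by (simp_all add: S_def I01)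
    fix x assume x: "0 < F x" "F x < 1"
    show "\<bar>S x\<bar> < a" using I_less x by (simp add: S_def)
    have "(I has_real_derivative inverse (g (I (F x)))) (at (F x))"
    proof (rule DERIV_inverse_function[OF G(1) _ x])
      show "g (I (F x)) \<noteq> 0" using g(4)[OF I_less[OF x]] by simp
      show "isCont I (F x)"
        using contI x by (intro continuous_on_interior[of "{0..1}"]) (auto simp: interior_atLeastAtMost_real)
    qed (use GI in auto)
    from DERIV_chain2[OF this F(1)]
    show "(S has_real_derivative f x / g (S x)) (at x)" by (simp add: S_def field_simps)
  qed (use f F in auto)
  then show thesis by (rule that)
qed

context transport begin

text \<open>
  The function \<open>K (S x) + R x - H x\<close>, with primitives \<open>K\<close>, \<open>H\<close> of \<open>k\<close>, \<open>h\<close>, is nondecreasing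
  where \<open>0 < F < 1\<close>; this avoids any change of variables through \<open>S\<close>.
\<close>

lemma integral_mono_transport:
  assumes k: "continuous_on UNIV k" "integrable lborel k" "\<And>y. a \<le> \<bar>y\<bar> \<Longrightarrow> k y = 0"
    and h: "continuous_on UNIV h" "integrable lborel h" "\<And>x. f x = 0 \<Longrightarrow> h x = 0"
    and R: "continuous_on UNIV R" "(R \<longlongrightarrow> 0) at_bot" "(R \<longlongrightarrow> 0) at_top" "\<And>x. f x = 0 \<Longrightarrow> R x = 0"
    and DR: "\<And>x. 0 < F x \<Longrightarrow> F x < 1 \<Longrightarrow> (R has_real_derivative r x) (at x)"
    and le: "\<And>x. 0 < F x \<Longrightarrow> F x < 1 \<Longrightarrow> h x \<le> k (S x) * (f x / g (S x)) + r x"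
  shows "(LINT x|lborel. h x) \<le> (LINT y|lborel. k y)"
proof -
  obtain K where K: "\<And>x. (K has_real_derivative k x) (at x)"
    "(K \<longlongrightarrow> 0) at_bot" "(K \<longlongrightarrow> (LINT x|lborel. k x)) at_top"
    using integrable_imp_primitive[OF k(1,2)] by metis
  obtain H where H: "\<And>x. (H has_real_derivative h x) (at x)"
    "(H \<longlongrightarrow> 0) at_bot" "(H \<longlongrightarrow> (LINT x|lborel. h x)) at_top"
    using integrable_imp_primitive[OF h(1,2)] by metis
  have contK: "continuous_on A K" for A by (intro continuous_at_imp_continuous_on ballI DERIV_isCont[OF K(1)])
  have contH: "continuous_on A H" for A by (intro continuous_at_imp_continuous_on ballI DERIV_isCont[OF H(1)])
  have contF: "continuous_on A F" for A by (intro continuous_at_imp_continuous_on ballI DERIV_isCont[OF DERIV_F])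
  note F = primitive_bounds[OF DERIV_F f_nonneg F_bot F_top]
  have a: "0 \<le> a" using S_le[of 0] by simp
  have "k y = 0" if "y \<le> - a \<or> a \<le> y" for y using that by (intro k(3)) auto
  then have Ka: "K (- a) = 0" "K a = (LINT x|lborel. k x)"
    by (intro primitive_left_zero[OF K(1,2)] primitive_right_zero[OF K(1,3)]; blast)+
  \<comment> \<open>The limits of \<open>D\<close> are 0 and the difference of the two integrals, so
    monotonicity of \<open>D\<close> is the claim. \<open>R\<close> carries a boundary term that
    vanishes at both ends.\<close>
  define D where "D = (\<lambda>x. K (S x) + R x - H x)"
  have contD: "continuous_on UNIV D"
    unfolding D_def by (intro continuous_intros R contH continuous_on_compose2[OF contK cont_S]) auto
  have KS: "((\<lambda>x. K (S x)) \<longlongrightarrow> 0) at_bot" "((\<lambda>x. K (S x)) \<longlongrightarrow> (LINT x|lborel. k x)) at_top"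
    using continuous_on_tendsto_compose[OF contK[of UNIV] S_bot] continuous_on_tendsto_compose[OF contK[of UNIV] S_top] Ka
    by auto
  have bot: "(D \<longlongrightarrow> 0) at_bot"
    using tendsto_diff[OF tendsto_add[OF KS(1) R(2)] H(2)] by (simp add: D_def)
  have top: "(D \<longlongrightarrow> (LINT x|lborel. k x) - (LINT x|lborel. h x)) at_top"
    using tendsto_diff[OF tendsto_add[OF KS(2) R(3)] H(3)] by (simp add: D_def)
  have D0: "D x = 0" if "F x = 0" for x
  proof -
    \<comment> \<open>Left of \<open>x\<close> the function \<open>F\<close> attains its minimum 0,
      so its derivative \<open>f\<close> vanishes there, and with it \<open>h\<close> and
      \<open>R\<close>.\<close>
    have f0: "f y = 0" if "y \<le> x" for y
    proof (rule DERIV_local_min[OF DERIV_F, of 1])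
      have "F y = 0" using monoD[OF F(1) that] F(2)[of y] \<open>F x = 0\<close> by simp
      then show "\<forall>z. \<bar>y - z\<bar> < 1 \<longrightarrow> F y \<le> F z" using F(2) by simp
    qed simp
    then have "H x = 0" by (intro primitive_left_zero[OF H(1,2)] h(3))
    then show ?thesis using that f0[of x] by (simp add: D_def S_0 Ka R(4))
  qed
  have D1: "D x = (LINT x|lborel. k x) - (LINT x|lborel. h x)" if "F x = 1" for x
  proof -
    have f0: "f y = 0" if "x \<le> y" for y
    proof (rule DERIV_local_max[OF DERIV_F, of 1])
      have "F y = 1" using monoD[OF F(1) that] F(3)[of y] \<open>F x = 1\<close> by simp
      then show "\<forall>z. \<bar>y - z\<bar> < 1 \<longrightarrow> F z \<le> F y" using F(3) by simp
    qed simp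
    then have "H x = (LINT x|lborel. h x)" by (intro primitive_right_zero[OF H(1,3)] h(3))
    then show ?thesis using that f0[of x] by (simp add: D_def S_1 Ka R(4))
  qed
  have DD: "\<exists>d. (D has_real_derivative d) (at x) \<and> 0 \<le> d" if x: "0 < F x" "F x < 1" for x
  proof (intro exI conjI)
    show "(D has_real_derivative k (S x) * (f x / g (S x)) + r x - h x) (at x)"
      unfolding D_def by (intro DERIV_diff DERIV_add DERIV_chain2[OF K(1)] DERIV_S DR H x)
    show "0 \<le> k (S x) * (f x / g (S x)) + r x - h x" using le[OF x] by simp
  qed
  \<comment> \<open>A median \<open>y\<close> separates the two degeneracies: left of it only
    \<open>F = 0\<close> can occur, right of it only \<open>F = 1\<close>.\<close>
  obtain b where b: "F b < 1 / 2"
    using order_tendstoD(2)[OF F_bot, of "1 / 2"] by (auto simp: eventually_at_bot_linorder)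
  obtain c where c: "1 / 2 < F c"
    using order_tendstoD(1)[OF F_top, of "1 / 2"] by (auto simp: eventually_at_top_linorder)
  have "b \<le> c" using monoD[OF F(1), of c b] b c by linarith
  then obtain y where y: "F y = 1 / 2" using IVT'[of F b "1 / 2" c] b c contF by auto
  have "0 \<le> D y"
  proof (rule left_limit_le_of_deriv_nonneg[OF contF contD bot F(2) D0])
    show "\<exists>d. (D has_real_derivative d) (at x) \<and> 0 \<le> d" if "x < y" "0 < F x" for x
      using monoD[OF F(1), of x y] that y by (intro DD) auto
  qed
  moreover have "D y \<le> (LINT x|lborel. k x) - (LINT x|lborel. h x)"
  proof (rule le_right_limit_of_deriv_nonneg[OF contF contD top F(3) D1])
    show "\<exists>d. (D has_real_derivative d) (at x) \<and> 0 \<le> d" if "y < x" "F x < 1" for x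
      using monoD[OF F(1), of y x] that y by (intro DD) auto
  qed
  ultimately show ?thesis by simp
qed

end

section \<open>The Gagliardo-Nirenberg inequality\<close>

text \<open>
  With \<open>S' = f / s\<close> and \<open>q = l S'\<close> this is the tangent inequality
  \<open>q powr (1 - p) \<ge> 1 + (1 - p) * (q - 1)\<close>, i.e. displacement convexity of \<open>\<integral> f powr p\<close>.
\<close>

lemma transport_pointwise:
  fixes f s l p :: real
  assumes "0 \<le> f" "0 < s" "0 < l" "1 < p"
  shows "p * f powr p \<le> l powr (1 - p) * s powr (p - 1) * f + (p - 1) * l * f powr p * (f / s)"
proof (cases "f = 0")
  case False
  with assms have f: "0 < f" by simp
  define q where "q = l * f / s"
  have q: "0 < q" using f assms by (simp add: q_def)
  \<comment> \<open>The left side is the tangent line at \<open>q = 1\<close>; it is compared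
    through \<open>ln q \<le> q - 1\<close> and then \<open>1 + z \<le> exp z\<close>.\<close>
  have "p - (p - 1) * q \<le> 1 + (1 - p) * ln q"
    using mult_left_mono[OF ln_le_minus_one[OF q], of "p - 1"] assms by (simp add: algebra_simps)
  also have "\<dots> \<le> q powr (1 - p)"
    using exp_ge_add_one_self[of "(1 - p) * ln q"] q by (simp add: powr_def)
  finally have "(p - (p - 1) * q) * f powr p \<le> q powr (1 - p) * f powr p"
    by (rule mult_right_mono) simp
  moreover have "q powr (1 - p) * f powr p = l powr (1 - p) * s powr (p - 1) * f"
  proof -
    have "f powr (1 - p) * f powr p = f" using f by (simp add: powr_add[symmetric])
    moreover have "q powr (1 - p) = l powr (1 - p) * f powr (1 - p) * s powr (p - 1)"
      using f assms by (simp add: q_def powr_mult powr_divide powr_diff)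
    ultimately show ?thesis by (simp add: mult_ac)
  qed
  moreover have "(p - (p - 1) * q) * f powr p = p * f powr p - (p - 1) * l * f powr p * (f / s)"
    by (simp add: q_def left_diff_distrib)
  ultimately show ?thesis by linarith
qed simp

text \<open>The pushforward bounds the integral of \<open>u\<close> times the square of
  \<open>S\<close> by the second moment of \<open>g\<close>. Displacement convexity, after
  integrating by parts, gives \<open>(p - 1) * E \<le> p * l * X\<close>, where \<open>X\<close>
  pairs \<open>v1\<close> with \<open>S\<close> under the weight \<open>u\<close>. Cauchy-Schwarz
  splits \<open>X\<close>.\<close>

lemma (in flux_profile) gagliardo_nirenberg:
  assumes mass: "(LINT x|lborel. u x) = 1" and E: "0 < (LINT x|lborel. u x powr p)"
    and a: "0 < a" and g: "continuous_on UNIV g" "integrable lborel g" "(LINT x|lborel. g x) = 1"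
      "\<And>y. \<bar>y\<bar> < a \<Longrightarrow> 0 < g y" "\<And>y. a \<le> \<bar>y\<bar> \<Longrightarrow> g y = 0"
    and int_g: "integrable lborel (\<lambda>y. y\<^sup>2 * g y)" "integrable lborel (\<lambda>y. g y powr p)"
    and Eg: "0 < (LINT y|lborel. g y powr p)" and Tg: "0 < (LINT y|lborel. y\<^sup>2 * g y)"
  shows "((p - 1) * (LINT x|lborel. u x powr p))\<^sup>2
    \<le> p\<^sup>2 * ((LINT y|lborel. g y powr p) / (LINT x|lborel. u x powr p)) powr (2 / (p - 1)) *
      (LINT y|lborel. y\<^sup>2 * g y) * (LINT x|lborel. u x * (v1 x)\<^sup>2)"
proof -
  let ?E = "LINT x|lborel. u x powr p" and ?Eg = "LINT y|lborel. g y powr p"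
    and ?T = "LINT y|lborel. y\<^sup>2 * g y" and ?J = "LINT x|lborel. u x * (v1 x)\<^sup>2"
  have pp: "0 < p - 1" "0 < p" using p_gt by auto
  obtain F where F: "\<And>x. (F has_real_derivative u x) (at x)" "(F \<longlongrightarrow> 0) at_bot" "(F \<longlongrightarrow> 1) at_top"
    using integrable_imp_primitive[OF continuous_u rapid_integrable[OF rapid_u continuous_u]] mass by metis
  obtain S where "transport u F g S a"
    using transport_exists[OF u_nonneg F a g] by blast
  then interpret transport u F g S a .
  have g_nonneg: "0 \<le> g y" for y
    using g(4,5)[of y] by (cases "\<bar>y\<bar> < a") auto
  have S2_le: "\<bar>(S x)\<^sup>2\<bar> \<le> a\<^sup>2" for x
    using S_le[of x] a by (simp add: abs_le_square_iff[symmetric])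
  have rapid: "rapid (\<lambda>x. u x * (S x)\<^sup>2)" "rapid (\<lambda>x. u x * v1 x * S x)" "rapid (\<lambda>x. u x powr p * S x)"
  proof -
    show "rapid (\<lambda>x. u x * (S x)\<^sup>2)" by (rule rapid_mult_bounded(2)[OF rapid_u S2_le])
    have "rapid (\<lambda>x. u x * v1 x)"
      unfolding u_v1 mult.assoc by (intro rapid_cmult rapid_mult rapid_u_powr rapid_u1 pp)
    then show "rapid (\<lambda>x. u x * v1 x * S x)" by (rule rapid_mult_bounded(2)[OF _ S_le])
    show "rapid (\<lambda>x. u x powr p * S x)" by (rule rapid_mult_bounded(2)[OF rapid_u_powr[OF pp(2)] S_le])
  qed
  have cont: "continuous_on UNIV (\<lambda>x. u x * (S x)\<^sup>2)" "continuous_on UNIV (\<lambda>x. u x * v1 x * S x)"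
    "continuous_on UNIV (\<lambda>x. u x powr p * S x)" "continuous_on UNIV (\<lambda>x. u x * (v1 x)\<^sup>2)"
    by (intro continuous_intros continuous_u continuous_v1 cont_S continuous_u_powr pp)+
  note int = rapid_integrable[OF rapid(1) cont(1)] rapid_integrable[OF rapid(2) cont(2)]
    rapid_integrable[OF rapid_u_v1_sq cont(4)] rapid_integrable[OF rapid_u_powr continuous_u_powr, OF pp(2) pp(2)]
  define X where "X = - (LINT x|lborel. u x * v1 x * S x)"
  have moment: "(LINT x|lborel. u x * (S x)\<^sup>2) \<le> ?T"
  proof (rule integral_mono_transport[where R = "\<lambda>_. 0" and r = "\<lambda>_. 0"])
    show "continuous_on UNIV (\<lambda>y. y\<^sup>2 * g y)" by (intro continuous_intros g)
    show "u x * (S x)\<^sup>2 \<le> (S x)\<^sup>2 * g (S x) * (u x / g (S x)) + 0" if "0 < F x" "F x < 1" for x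
      using g(4)[OF S_less[OF that]] by simp
  qed (use g int_g cont int in \<open>auto intro: DERIV_const\<close>)
  have CS: "X\<^sup>2 \<le> ?J * ?T"
  proof -
    \<comment> \<open>The minimiser of \<open>?J - 2 * c * X + c ^ 2 * ?T\<close>.\<close>
    define c where "c = X / ?T"
    have "0 \<le> (LINT x|lborel. u x * (v1 x + c * S x)\<^sup>2)"
      by (intro integral_nonneg_AE AE_I2) (use u_nonneg in auto)
    also have "\<dots> = (LINT x|lborel. u x * (v1 x)\<^sup>2 + 2 * c * (u x * v1 x * S x) + c\<^sup>2 * (u x * (S x)\<^sup>2))"
      by (simp add: power2_eq_square algebra_simps)
    also have "\<dots> = ?J - 2 * c * X + c\<^sup>2 * (LINT x|lborel. u x * (S x)\<^sup>2)"
      using int by (simp add: X_def)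
    also have "\<dots> \<le> ?J - 2 * c * X + c\<^sup>2 * ?T"
      by (intro add_left_mono mult_left_mono moment) auto
    also have "\<dots> = ?J - X\<^sup>2 / ?T"
      using Tg by (simp add: c_def power2_eq_square field_simps)
    finally show ?thesis using Tg by (simp add: field_simps)
  qed
  \<comment> \<open>The dilation factor that gives \<open>g\<close> the entropy integral of
    \<open>u\<close>, that is \<open>l powr (1 - p) * ?Eg = ?E\<close>.\<close>
  define l where "l = (?Eg / ?E) powr (1 / (p - 1))"
  have l: "0 < l" using E Eg by (simp add: l_def)
  have "(LINT x|lborel. p * u x powr p + p * l * (u x * v1 x * S x)) \<le> (LINT y|lborel. l powr (1 - p) * g y powr p)"
  proof (rule integral_mono_transport)
    \<comment> \<open>Its derivative produces the last term of \<open>transport_pointwise\<close>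
      together with \<open>p * l * (u * v1 * S)\<close>, which accordingly also appears in
      \<open>h\<close>.\<close>
    let ?R = "\<lambda>x. (p - 1) * l * (u x powr p * S x)"
    show "continuous_on UNIV (\<lambda>y. l powr (1 - p) * g y powr p)"
      using g_nonneg pp by (intro continuous_intros continuous_on_powr' g) auto
    show "continuous_on UNIV (\<lambda>x. p * u x powr p + p * l * (u x * v1 x * S x))"
      by (intro continuous_on_add continuous_on_mult_left cont continuous_u_powr pp)
    show "continuous_on UNIV ?R" by (intro continuous_on_mult_left cont)
    show "(?R \<longlongrightarrow> 0) at_bot" "(?R \<longlongrightarrow> 0) at_top"
      by (intro rapid_tendsto_0 rapid_cmult rapid)+
    fix x assume x: "0 < F x" "F x < 1"
    show "(?R has_real_derivative (p - 1) * l * (p / (p - 1) * (u x * v1 x) * S x + u x / g (S x) * u x powr p)) (at x)"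
      by (intro DERIV_cmult DERIV_mult DERIV_u_powr DERIV_S x)
    have s: "0 < g (S x)" by (rule g(4)[OF S_less[OF x]])
    have "l powr (1 - p) * g (S x) powr p * (u x / g (S x)) = l powr (1 - p) * g (S x) powr (p - 1) * u x"
      using s by (simp add: powr_diff)
    moreover have "(p - 1) * l * (p / (p - 1) * (u x * v1 x) * S x + u x / g (S x) * u x powr p)
        = p * l * (u x * v1 x * S x) + (p - 1) * l * u x powr p * (u x / g (S x))"
      using p_gt by (simp add: field_simps)
    ultimately show "p * u x powr p + p * l * (u x * v1 x * S x) \<le> l powr (1 - p) * g (S x) powr p * (u x / g (S x)) +
        (p - 1) * l * (p / (p - 1) * (u x * v1 x) * S x + u x / g (S x) * u x powr p)"
      using transport_pointwise[OF u_nonneg s l p_gt, of x] by linarith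
  qed (use g int_g int in auto)
  then have "p * ?E - p * l * X \<le> l powr (1 - p) * ?Eg"
    using int int_g by (simp add: X_def)
  also have "l powr (1 - p) = ?E / ?Eg"
  proof -
    have "1 / (p - 1) * (1 - p) = - 1" using p_gt by (simp add: field_simps)
    then have "l powr (1 - p) = (?Eg / ?E) powr (- 1)" by (simp only: l_def powr_powr)
    then show ?thesis using E Eg by (simp add: powr_minus)
  qed
  also have "?E / ?Eg * ?Eg = ?E" using Eg by simp
  finally have "(p - 1) * ?E \<le> p * l * X" by (simp add: algebra_simps)
  then have "((p - 1) * ?E)\<^sup>2 \<le> (p * l * X)\<^sup>2"
    using E p_gt by (intro power_mono) auto
  also have "\<dots> = (p * l)\<^sup>2 * X\<^sup>2" by (simp add: power_mult_distrib)
  also have "\<dots> \<le> (p * l)\<^sup>2 * (?J * ?T)" by (intro mult_left_mono CS) auto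
  also have "l\<^sup>2 = (?Eg / ?E) powr (2 / (p - 1))"
    by (simp add: l_def power2_eq_square powr_add[symmetric])
  then have "(p * l)\<^sup>2 * (?J * ?T) = p\<^sup>2 * (?Eg / ?E) powr (2 / (p - 1)) * ?T * ?J"
    by (simp add: power_mult_distrib)
  finally show ?thesis .
qed

section \<open>Integrals depending on time\<close>

text \<open>The mean value theorem turns the bound on \<open>f'\<close> into a bound on the
  difference quotients, so dominated convergence applies along sequences.\<close>

lemma DERIV_integral_dominated:
  fixes f f' :: "real \<Rightarrow> real \<Rightarrow> real"
  assumes t: "t \<in> {a<..<b}"
    and deriv: "\<And>x s. s \<in> {a<..<b} \<Longrightarrow> ((\<lambda>s. f x s) has_real_derivative f' x s) (at s)"
    and int: "\<And>s. s \<in> {a<..<b} \<Longrightarrow> integrable lborel (\<lambda>x. f x s)"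
    and meas: "(\<lambda>x. f' x t) \<in> borel_measurable lborel"
    and bound: "\<And>x s. s \<in> {a<..<b} \<Longrightarrow> \<bar>f' x s\<bar> \<le> g x" and g: "integrable lborel g"
  shows "((\<lambda>s. LINT x|lborel. f x s) has_real_derivative (LINT x|lborel. f' x t)) (at t)"
proof -
  let ?q = "\<lambda>x s. (f x s - f x t) / (s - t)"
  have "((\<lambda>s. LINT x|lborel. ?q x s) \<longlongrightarrow> (LINT x|lborel. f' x t)) (at t within {a<..<b})"
    unfolding tendsto_at_iff_sequentially o_def
  proof (intro allI impI integral_dominated_convergence[OF meas _ g] AE_I2)
    fix X :: "nat \<Rightarrow> real" and x n
    assume X: "\<forall>i. X i \<in> {a<..<b} - {t}" "X \<longlonglongrightarrow> t"
    then have Xn: "X n \<in> {a<..<b}" "X n \<noteq> t" for n by auto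
    show "(\<lambda>x. ?q x (X n)) \<in> borel_measurable lborel"
      using int[OF Xn(1)] int[OF t] by (intro borel_measurable_divide borel_measurable_diff) auto
    show "(\<lambda>n. ?q x (X n)) \<longlonglongrightarrow> f' x t"
      using deriv[OF t, of x] Xn(2) X(2)
      unfolding has_field_derivative_iff tendsto_at_iff_sequentially o_def by auto
    obtain z where z: "z \<in> {a<..<b}" "f x (X n) - f x t = (X n - t) * f' x z"
    proof (cases "X n < t")
      case True
      obtain z where "X n < z" "z < t" "f x t - f x (X n) = (t - X n) * f' x z"
        using MVT2[OF True, of "f x" "f' x"] deriv Xn(1)[of n] t by auto
      with that[of z] Xn(1)[of n] t show thesis by (simp add: algebra_simps)
    next
      case False
      then have "t < X n" using Xn(2)[of n] by simp
      then obtain z where "t < z" "z < X n" "f x (X n) - f x t = (X n - t) * f' x z"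
        using MVT2[of t "X n" "f x" "f' x"] deriv Xn(1)[of n] t by auto
      with that[of z] Xn(1)[of n] t show thesis by simp
    qed
    then have "?q x (X n) = f' x z" using Xn(2)[of n] by simp
    then show "norm (?q x (X n)) \<le> g x" using bound[OF z(1)] by simp
  qed
  moreover have "(LINT x|lborel. ?q x s) = ((LINT x|lborel. f x s) - (LINT x|lborel. f x t)) / (s - t)"
    if "s \<in> {a<..<b}" for s
    using int[OF that] int[OF t] by simp
  then have "\<forall>\<^sub>F s in at t within {a<..<b}.
      (LINT x|lborel. ?q x s) = ((LINT x|lborel. f x s) - (LINT x|lborel. f x t)) / (s - t)"
    unfolding eventually_at_filter by (intro always_eventually allI impI)
  ultimately have "((\<lambda>s. ((LINT x|lborel. f x s) - (LINT x|lborel. f x t)) / (s - t))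
      \<longlongrightarrow> (LINT x|lborel. f' x t)) (at t within {a<..<b})"
    by (rule Lim_transform_eventually)
  then show ?thesis
    unfolding has_field_derivative_iff using at_within_open[OF t] by simp
qed

lemma continuous_on_integral_dominated:
  fixes f :: "real \<Rightarrow> real \<Rightarrow> real"
  assumes cont: "\<And>x. continuous_on T (f x)"
    and meas: "\<And>s. s \<in> T \<Longrightarrow> (\<lambda>x. f x s) \<in> borel_measurable lborel"
    and bound: "\<And>x s. s \<in> T \<Longrightarrow> \<bar>f x s\<bar> \<le> g x" and g: "integrable lborel g"
  shows "continuous_on T (\<lambda>s. LINT x|lborel. f x s)"
  unfolding continuous_on_sequentially o_def
proof (intro allI ballI impI integral_dominated_convergence[OF _ _ g] AE_I2)
  fix X :: "nat \<Rightarrow> real" and s x n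
  assume s: "s \<in> T" and X: "(\<forall>n. X n \<in> T) \<and> X \<longlonglongrightarrow> s"
  then show "(\<lambda>n. f x (X n)) \<longlonglongrightarrow> f x s"
    using cont[of x] unfolding continuous_on_sequentially o_def by blast
  show "(\<lambda>x. f x s) \<in> borel_measurable lborel" "(\<lambda>x. f x (X n)) \<in> borel_measurable lborel"
    "norm (f x (X n)) \<le> g x"
    using meas bound s X by auto
qed

text \<open>Integrable dominating functions that are uniform in time: weights 0 and 2 serve for
  \<open>f\<close>, weights 2 and 4 for its second moment.\<close>

lemma rapidly_decaying_onE:
  assumes "rapidly_decaying_on I f"
  obtains M where "0 \<le> M" "\<And>x t. t \<in> I \<Longrightarrow> \<bar>f x t\<bar> \<le> M"
    "\<And>x t. t \<in> I \<Longrightarrow> \<bar>f x t\<bar> \<le> M * inverse (1 + x\<^sup>2)"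
    "\<And>x t. t \<in> I \<Longrightarrow> x\<^sup>2 * \<bar>f x t\<bar> \<le> M * inverse (1 + x\<^sup>2)"
proof -
  obtain A where A: "\<And>x t. t \<in> I \<Longrightarrow> \<bar>x\<bar> ^ 0 * \<bar>f x t\<bar> \<le> A"
    using assms unfolding rapidly_decaying_on_def by metis
  obtain B where B: "\<And>x t. t \<in> I \<Longrightarrow> \<bar>x\<bar> ^ 2 * \<bar>f x t\<bar> \<le> B"
    using assms unfolding rapidly_decaying_on_def by metis
  obtain C where C: "\<And>x t. t \<in> I \<Longrightarrow> \<bar>x\<bar> ^ 4 * \<bar>f x t\<bar> \<le> C"
    using assms unfolding rapidly_decaying_on_def by metis
  define M where "M = \<bar>A\<bar> + 2 * \<bar>B\<bar> + \<bar>C\<bar>"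
  have pos: "0 < 1 + x\<^sup>2" for x :: real by (simp add: add_pos_nonneg)
  have *: "\<bar>f x t\<bar> \<le> \<bar>A\<bar>" "x\<^sup>2 * \<bar>f x t\<bar> \<le> \<bar>B\<bar>" "x ^ 4 * \<bar>f x t\<bar> \<le> \<bar>C\<bar>" if "t \<in> I" for x t
    using A[OF that, of x] B[OF that, of x] C[OF that, of x] by (auto simp: power_abs)
  show thesis
  proof
    show "0 \<le> M" by (simp add: M_def)
    show "\<bar>f x t\<bar> \<le> M" if "t \<in> I" for x t using *[OF that, of x] unfolding M_def by linarith
    show "\<bar>f x t\<bar> \<le> M * inverse (1 + x\<^sup>2)" if "t \<in> I" for x t
    proof -
      have "\<bar>f x t\<bar> * (1 + x\<^sup>2) = \<bar>f x t\<bar> + x\<^sup>2 * \<bar>f x t\<bar>" by (simp add: algebra_simps)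
      also have "\<dots> \<le> M" using *[OF that, of x] unfolding M_def by linarith
      finally show ?thesis using pos[of x] by (simp add: field_simps)
    qed
    show "x\<^sup>2 * \<bar>f x t\<bar> \<le> M * inverse (1 + x\<^sup>2)" if "t \<in> I" for x t
    proof -
      have "(x\<^sup>2 * \<bar>f x t\<bar>) * (1 + x\<^sup>2) = x\<^sup>2 * \<bar>f x t\<bar> + x ^ 4 * \<bar>f x t\<bar>"
        by (simp add: distrib_left power2_eq_square power4_eq_xxxx)
      also have "\<dots> \<le> M" using *[OF that, of x] unfolding M_def by linarith
      finally show ?thesis using pos[of x] by (simp add: field_simps)
    qed
  qed
qed

lemma rapidly_decaying_on_imp_rapid:
  assumes "rapidly_decaying_on I f" "t \<in> I" shows "rapid (\<lambda>x. f x t)"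
  using assms unfolding rapidly_decaying_on_def by (intro rapidI) blast

lemma integral_powr_pos:
  fixes f :: "real \<Rightarrow> real"
  assumes "\<And>x. 0 \<le> f x" "integrable lborel (\<lambda>x. f x powr p)" "(LINT x|lborel. f x) = 1"
  shows "0 < (LINT x|lborel. f x powr p)"
proof (rule ccontr)
  assume "\<not> ?thesis"
  moreover have "0 \<le> (LINT x|lborel. f x powr p)" by (intro integral_nonneg_AE) auto
  ultimately have "(LINT x|lborel. f x powr p) = 0" by simp
  then have "AE x in lborel. f x powr p = 0"
    using assms(2) by (subst (asm) integral_nonneg_eq_0_iff_AE) auto
  then have "AE x in lborel. f x = 0" by simp
  then have "(LINT x|lborel. f x) = 0" by (rule integral_eq_zero_AE)
  with assms(3) show False by simp
qed

lemma second_moment_pos: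
  fixes f :: "real \<Rightarrow> real"
  assumes "\<And>x. 0 \<le> f x" "integrable lborel (\<lambda>x. x\<^sup>2 * f x)" "(LINT x|lborel. f x) = 1"
  shows "0 < second_moment f"
proof (rule ccontr)
  assume "\<not> ?thesis"
  moreover have "0 \<le> second_moment f" unfolding second_moment_def
    by (intro integral_nonneg_AE) (use assms(1) in auto)
  ultimately have "(LINT x|lborel. x\<^sup>2 * f x) = 0" by (simp add: second_moment_def)
  then have "AE x in lborel. x\<^sup>2 * f x = 0"
    using assms(1,2) by (subst (asm) integral_nonneg_eq_0_iff_AE) auto
  then have "AE x in lborel. f x = 0"
    using AE_lborel_singleton[of "0::real"] by eventually_elim simp
  then have "(LINT x|lborel. f x) = 0" by (rule integral_eq_zero_AE)
  with assms(3) show False by simp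
qed

section \<open>Evolution of entropy and second moment\<close>

locale fast_decaying_solution =
  fixes p :: real and u :: "real \<Rightarrow> real \<Rightarrow> real"
  assumes p_gt: "1 < p"
    and solves: "solves_equation p u"
    and cont: "continuous_on (UNIV \<times> {0..}) (\<lambda>(x, t). u x t)"
    and smooth: "smooth_for_positive_times u"
    and nonneg: "\<And>x t. 0 \<le> t \<Longrightarrow> 0 \<le> u x t"
    and decay: "spatially_fast_decaying u"
    and mass_0: "(LINT x|lborel. u x 0) = 1"
begin

abbreviation (input) entropy :: "real \<Rightarrow> real" where
  "entropy t \<equiv> LINT x|lborel. u x t powr p"

abbreviation (input) moment :: "real \<Rightarrow> real" where
  "moment t \<equiv> LINT x|lborel. x\<^sup>2 * u x t"

lemma DERIV_dx: "f \<in> iterated_partials u \<Longrightarrow> 0 < t \<Longrightarrow> ((\<lambda>y. f y t) has_real_derivative dx f x t) (at x)"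
  and DERIV_dt: "f \<in> iterated_partials u \<Longrightarrow> 0 < t \<Longrightarrow> ((\<lambda>s. f x s) has_real_derivative dt f x t) (at t)"
  using smooth unfolding smooth_for_positive_times_def dx_def dt_def
  by (auto simp: DERIV_deriv_iff_real_differentiable)

lemma rapid_partial: "f \<in> iterated_partials u \<Longrightarrow> 0 < t \<Longrightarrow> rapid (\<lambda>x. f x t)"
  using decay unfolding spatially_fast_decaying_def
  by (intro rapidly_decaying_on_imp_rapid[of "{t..t + 1}"]) auto

lemma continuous_partial:
  assumes "f \<in> iterated_partials u" "0 < t" shows "continuous_on UNIV (\<lambda>x. f x t)"
  by (intro continuous_at_imp_continuous_on ballI DERIV_isCont[OF DERIV_dx[OF assms]])

lemma continuous_space: "0 \<le> t \<Longrightarrow> continuous_on UNIV (\<lambda>x. u x t)"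
  by (rule continuous_on_compose2[OF cont, of UNIV "\<lambda>x. (x, t)", simplified])
    (auto intro!: continuous_intros)

lemma continuous_time: "continuous_on {0..} (\<lambda>t. u x t)"
  by (rule continuous_on_compose2[OF cont, of "{0..}" "\<lambda>t. (x, t)", simplified])
    (auto intro!: continuous_intros)

lemma rapid_u: "0 \<le> t \<Longrightarrow> rapid (\<lambda>x. u x t)"
  using decay unfolding spatially_fast_decaying_def
  by (intro rapidly_decaying_on_imp_rapid[of "{0..t + 1}"]) auto

lemma integrable_u: "0 \<le> t \<Longrightarrow> integrable lborel (\<lambda>x. u x t)"
  by (intro rapid_integrable rapid_u continuous_space)

lemma integrable_moment: "0 \<le> t \<Longrightarrow> integrable lborel (\<lambda>x. x\<^sup>2 * u x t)"
  by (intro rapid_integrable rapid_power_mult rapid_u continuous_intros continuous_space)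

lemma integrable_entropy: "0 \<le> t \<Longrightarrow> integrable lborel (\<lambda>x. u x t powr p)"
  using rapid_powr[OF rapid_u, of t p] nonneg p_gt
  by (intro rapid_integrable continuous_on_powr' continuous_intros continuous_space) auto

text \<open>The equation identifies the second derivative of the flux with
  \<open>- (p - 1) * dt u\<close>, which thereby inherits continuity and decay from the partial
  derivatives of \<open>u\<close>.\<close>

lemma flux_profile:
  assumes t: "0 < t"
  shows "flux_profile p (\<lambda>x. u x t) (\<lambda>x. dx u x t) (\<lambda>x. dx (dx u) x t)
    (\<lambda>x. dx (\<lambda>y s. u y s powr (p - 1)) x t) (\<lambda>x. dx (dx (\<lambda>y s. u y s powr (p - 1))) x t)
    (\<lambda>x. dx (flux p u) x t) (\<lambda>x. - (p - 1) * dt u x t)"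
proof
  have v: "twice_differentiable_in_space (\<lambda>x t. u x t powr (p - 1))"
    and w: "twice_differentiable_in_space (flux p u)"
    and eq: "dt u x t = - (1 / (p - 1)) * dx (dx (flux p u)) x t" for x
    using solves t unfolding solves_equation_def by auto
  show "1 < p" by (rule p_gt)
  show "0 \<le> u x t" for x using nonneg t by simp
  show "((\<lambda>x. u x t) has_real_derivative dx u x t) (at x)"
    "((\<lambda>x. dx u x t) has_real_derivative dx (dx u) x t) (at x)" for x
    by (intro DERIV_dx t iterated_partials.intros)+
  show "rapid (\<lambda>x. u x t)" "rapid (\<lambda>x. dx (dx u) x t)" "rapid (\<lambda>x. - (p - 1) * dt u x t)"
    by (intro rapid_cmult rapid_partial t iterated_partials.intros)+
  show "continuous_on UNIV (\<lambda>x. - (p - 1) * dt u x t)"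
    by (intro continuous_on_mult_left continuous_partial t iterated_partials.intros)
  show "((\<lambda>y. u y t powr (p - 1)) has_real_derivative dx (\<lambda>y s. u y s powr (p - 1)) x t) (at x)"
    "((\<lambda>x. dx (\<lambda>y s. u y s powr (p - 1)) x t) has_real_derivative dx (dx (\<lambda>y s. u y s powr (p - 1))) x t) (at x)" for x
    using v t unfolding twice_differentiable_in_space_def
    by (auto simp: DERIV_deriv_iff_real_differentiable dx_def)
  show "((\<lambda>y. u y t powr p * dx (dx (\<lambda>y s. u y s powr (p - 1))) y t) has_real_derivative dx (flux p u) x t) (at x)" for x
  proof -
    have "((\<lambda>y. flux p u y t) has_real_derivative dx (flux p u) x t) (at x)"
      using w t unfolding twice_differentiable_in_space_def
      by (subst dx_def) (auto simp: DERIV_deriv_iff_real_differentiable)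
    then show ?thesis by (simp add: flux_def)
  qed
  show "((\<lambda>x. dx (flux p u) x t) has_real_derivative - (p - 1) * dt u x t) (at x)" for x
  proof -
    have "((\<lambda>y. dx (flux p u) y t) has_real_derivative dx (dx (flux p u)) x t) (at x)"
      using w t unfolding twice_differentiable_in_space_def
      by (subst (2) dx_def) (auto simp: DERIV_deriv_iff_real_differentiable)
    moreover have "dx (dx (flux p u)) x t = - (p - 1) * dt u x t"
      unfolding eq using p_gt by (simp add: field_simps)
    ultimately show ?thesis by simp
  qed
qed

text \<open>Derivatives are controlled only away from the initial time, hence the left endpoint
  \<open>t / 2\<close>.\<close>

lemma bounds_near_positive_time:
  assumes "0 < t" "f \<in> iterated_partials u"
  obtains M where "0 \<le> M" "\<And>x s. s \<in> {t / 2<..<t + 1} \<Longrightarrow> \<bar>f x s\<bar> \<le> M"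
    "\<And>x s. s \<in> {t / 2<..<t + 1} \<Longrightarrow> \<bar>f x s\<bar> \<le> M * inverse (1 + x\<^sup>2)"
    "\<And>x s. s \<in> {t / 2<..<t + 1} \<Longrightarrow> x\<^sup>2 * \<bar>f x s\<bar> \<le> M * inverse (1 + x\<^sup>2)"
proof -
  have "rapidly_decaying_on {t / 2..t + 1} f"
    using decay assms half_gt_zero unfolding spatially_fast_decaying_def by blast
  then have "rapidly_decaying_on {t / 2<..<t + 1} f"
    unfolding rapidly_decaying_on_def by (meson atLeastAtMost_iff greaterThanLessThan_iff less_imp_le)
  then show thesis by (rule rapidly_decaying_onE) (rule that)
qed

lemma DERIV_mass: assumes t: "0 < t" shows "((\<lambda>s. LINT x|lborel. u x s) has_real_derivative 0) (at t)"
proof -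
  interpret flux_profile p "\<lambda>x. u x t" "\<lambda>x. dx u x t" "\<lambda>x. dx (dx u) x t"
    "\<lambda>x. dx (\<lambda>y s. u y s powr (p - 1)) x t" "\<lambda>x. dx (dx (\<lambda>y s. u y s powr (p - 1))) x t"
    "\<lambda>x. dx (flux p u) x t" "\<lambda>x. - (p - 1) * dt u x t"
    by (rule flux_profile[OF t])
  have dtu: "dt u \<in> iterated_partials u" by (intro iterated_partials.intros)
  obtain M where M: "\<And>x s. s \<in> {t / 2<..<t + 1} \<Longrightarrow> \<bar>dt u x s\<bar> \<le> M * inverse (1 + x\<^sup>2)"
    using bounds_near_positive_time[OF t dtu] by metis
  have "((\<lambda>s. LINT x|lborel. u x s) has_real_derivative (LINT x|lborel. dt u x t)) (at t)"
  proof (rule DERIV_integral_dominated[OF _ _ _ _ M integrable_inverse_quadratic])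
    show "((\<lambda>s. u x s) has_real_derivative dt u x s) (at s)" if "s \<in> {t / 2<..<t + 1}" for x s
      using that t by (intro DERIV_dt iterated_partials.intros) auto
    show "integrable lborel (\<lambda>x. u x s)" if "s \<in> {t / 2<..<t + 1}" for s
      using that t by (intro integrable_u) auto
    show "(\<lambda>x. dt u x t) \<in> borel_measurable lborel"
      using borel_measurable_continuous_onI[OF continuous_partial[OF dtu t]] by simp
  qed (use t in auto)
  then show ?thesis using integral_w2 p_gt by simp
qed

lemma DERIV_moment:
  assumes t: "0 < t"
  shows "((\<lambda>s. moment s) has_real_derivative - (2 / (p - 1)) * (LINT x|lborel. flux p u x t)) (at t)"
proof -
  interpret flux_profile p "\<lambda>x. u x t" "\<lambda>x. dx u x t" "\<lambda>x. dx (dx u) x t"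
    "\<lambda>x. dx (\<lambda>y s. u y s powr (p - 1)) x t" "\<lambda>x. dx (dx (\<lambda>y s. u y s powr (p - 1))) x t"
    "\<lambda>x. dx (flux p u) x t" "\<lambda>x. - (p - 1) * dt u x t"
    by (rule flux_profile[OF t])
  have dtu: "dt u \<in> iterated_partials u" by (intro iterated_partials.intros)
  obtain M where M: "\<And>x s. s \<in> {t / 2<..<t + 1} \<Longrightarrow> x\<^sup>2 * \<bar>dt u x s\<bar> \<le> M * inverse (1 + x\<^sup>2)"
    using bounds_near_positive_time[OF t dtu] by metis
  have "((\<lambda>s. LINT x|lborel. x\<^sup>2 * u x s) has_real_derivative (LINT x|lborel. x\<^sup>2 * dt u x t)) (at t)"
  proof (rule DERIV_integral_dominated[OF _ _ _ _ _ integrable_inverse_quadratic])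
    show "((\<lambda>s. x\<^sup>2 * u x s) has_real_derivative x\<^sup>2 * dt u x s) (at s)" if "s \<in> {t / 2<..<t + 1}" for x s
      using that t by (intro DERIV_cmult DERIV_dt iterated_partials.intros) auto
    show "integrable lborel (\<lambda>x. x\<^sup>2 * u x s)" if "s \<in> {t / 2<..<t + 1}" for s
      using that t by (intro integrable_moment) auto
    show "(\<lambda>x. x\<^sup>2 * dt u x t) \<in> borel_measurable lborel"
      using borel_measurable_continuous_onI[OF continuous_partial[OF dtu t]] by simp
    show "\<bar>x\<^sup>2 * dt u x s\<bar> \<le> M * inverse (1 + x\<^sup>2)" if "s \<in> {t / 2<..<t + 1}" for x s
      using M[OF that] by (simp add: abs_mult)
  qed (use t in auto)
  moreover have "(LINT x|lborel. x\<^sup>2 * dt u x t) = - (2 / (p - 1)) * (LINT x|lborel. flux p u x t)"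
  proof -
    have "(LINT x|lborel. x\<^sup>2 * (- (p - 1) * dt u x t)) = (LINT x|lborel. - (p - 1) * (x\<^sup>2 * dt u x t))"
      by (simp add: mult_ac)
    with integral_sq_w2 have "- (p - 1) * (LINT x|lborel. x\<^sup>2 * dt u x t) = 2 * (LINT x|lborel. flux p u x t)"
      by (simp add: flux_def)
    then show ?thesis using p_gt by (simp add: field_simps)
  qed
  ultimately show ?thesis by simp
qed

lemma DERIV_entropy:
  assumes t: "0 < t"
  shows "((\<lambda>s. entropy s) has_real_derivative p * (LINT x|lborel. u x t powr (p - 1) * dt u x t)) (at t)"
proof -
  have dtu: "dt u \<in> iterated_partials u" by (intro iterated_partials.intros)
  have uu: "u \<in> iterated_partials u" by (intro iterated_partials.intros)
  obtain M where M: "\<And>x s. s \<in> {t / 2<..<t + 1} \<Longrightarrow> \<bar>dt u x s\<bar> \<le> M * inverse (1 + x\<^sup>2)"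
    using bounds_near_positive_time[OF t dtu] by metis
  obtain N where N: "0 \<le> N" "\<And>x s. s \<in> {t / 2<..<t + 1} \<Longrightarrow> \<bar>u x s\<bar> \<le> N"
    using bounds_near_positive_time[OF t uu] by metis
  have "((\<lambda>s. LINT x|lborel. u x s powr p) has_real_derivative (LINT x|lborel. p * u x t powr (p - 1) * dt u x t)) (at t)"
  proof (rule DERIV_integral_dominated[OF _ _ _ _ _ integrable_inverse_quadratic])
    show "((\<lambda>s. u x s powr p) has_real_derivative p * u x s powr (p - 1) * dt u x s) (at s)"
      if "s \<in> {t / 2<..<t + 1}" for x s
      using that t by (intro DERIV_powr_nonneg[where S = "{0<..}"] DERIV_dt iterated_partials.intros nonneg p_gt) auto
    show "integrable lborel (\<lambda>x. u x s powr p)" if "s \<in> {t / 2<..<t + 1}" for s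
      using that t by (intro integrable_entropy) auto
    show "(\<lambda>x. p * u x t powr (p - 1) * dt u x t) \<in> borel_measurable lborel"
      using borel_measurable_continuous_onI[OF continuous_partial[OF dtu t]]
        borel_measurable_continuous_onI[OF continuous_partial[OF uu t]] by simp
    show "\<bar>p * u x s powr (p - 1) * dt u x s\<bar> \<le> (p * N powr (p - 1) * M) * inverse (1 + x\<^sup>2)"
      if s: "s \<in> {t / 2<..<t + 1}" for x s
    proof -
      have "0 \<le> u x s" using s t by (intro nonneg) auto
      then have "u x s powr (p - 1) \<le> N powr (p - 1)"
        using N(2)[OF s, of x] p_gt by (intro powr_mono2) auto
      then have "p * (u x s powr (p - 1) * \<bar>dt u x s\<bar>) \<le> p * (N powr (p - 1) * (M * inverse (1 + x\<^sup>2)))"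
        using p_gt M[OF s, of x] by (intro mult_left_mono mult_mono) auto
      then show ?thesis using p_gt by (simp add: abs_mult mult_ac)
    qed
  qed (use t in auto)
  then show ?thesis by (simp add: mult.assoc)
qed

text \<open>Derivatives may blow up as time tends to 0, so the initial time is reached by continuity
  alone; with derivatives at positive times this is enough for monotonicity from time 0.\<close>

lemma continuous_mass: "continuous_on {0..T} (\<lambda>s. LINT x|lborel. u x s)"
  and continuous_moment: "continuous_on {0..T} (\<lambda>s. moment s)"
  and continuous_entropy: "continuous_on {0..T} (\<lambda>s. entropy s)"
proof -
  \<comment> \<open>\<open>T\<close> is arbitrary, whereas decay down to time 0 is stated for
    positive horizons.\<close>
  have "rapidly_decaying_on {0..\<bar>T\<bar> + 1} u" using decay unfolding spatially_fast_decaying_def by simp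
  then have "rapidly_decaying_on {0..T} u"
    unfolding rapidly_decaying_on_def
    by (meson abs_ge_self add_increasing2 atLeastAtMost_iff order_trans zero_le_one)
  then obtain M where M: "0 \<le> M" "\<And>x s. s \<in> {0..T} \<Longrightarrow> \<bar>u x s\<bar> \<le> M"
    "\<And>x s. s \<in> {0..T} \<Longrightarrow> \<bar>u x s\<bar> \<le> M * inverse (1 + x\<^sup>2)"
    "\<And>x s. s \<in> {0..T} \<Longrightarrow> x\<^sup>2 * \<bar>u x s\<bar> \<le> M * inverse (1 + x\<^sup>2)"
    by (rule rapidly_decaying_onE) blast
  have ct: "continuous_on {0..T} (u x)" for x
    by (rule continuous_on_subset[OF continuous_time]) auto
  have meas [measurable]: "(\<lambda>x. u x s) \<in> borel_measurable borel" if "s \<in> {0..T}" for s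
    using borel_measurable_continuous_onI[OF continuous_space] that by simp
  show "continuous_on {0..T} (\<lambda>s. LINT x|lborel. u x s)"
    by (rule continuous_on_integral_dominated[OF ct _ M(3) integrable_inverse_quadratic]) (simp_all add: meas)
  show "continuous_on {0..T} (\<lambda>s. moment s)"
  proof (rule continuous_on_integral_dominated[OF _ _ _ integrable_inverse_quadratic])
    show "continuous_on {0..T} (\<lambda>s. x\<^sup>2 * u x s)" for x by (intro continuous_intros ct)
    show "\<bar>x\<^sup>2 * u x s\<bar> \<le> M * inverse (1 + x\<^sup>2)" if "s \<in> {0..T}" for x s
      using M(4)[OF that] by (simp add: abs_mult)
    show "(\<lambda>x. x\<^sup>2 * u x s) \<in> borel_measurable lborel" if "s \<in> {0..T}" for s
      using meas[OF that] by simp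
  qed
  show "continuous_on {0..T} (\<lambda>s. entropy s)"
  proof (rule continuous_on_integral_dominated[OF _ _ _ integrable_inverse_quadratic])
    show "continuous_on {0..T} (\<lambda>s. u x s powr p)" for x
      using nonneg p_gt by (intro continuous_on_powr' ct continuous_intros) auto
    show "\<bar>u x s powr p\<bar> \<le> (M powr (p - 1) * M) * inverse (1 + x\<^sup>2)" if s: "s \<in> {0..T}" for x s
    proof -
      have u: "0 \<le> u x s" using s by (intro nonneg) auto
      then have "u x s powr p = u x s powr (p - 1) * u x s"
        by (cases "u x s = 0") (auto simp: powr_diff)
      also have "\<dots> \<le> M powr (p - 1) * (M * inverse (1 + x\<^sup>2))"
        using M(2,3)[OF s, of x] u p_gt by (intro mult_mono powr_mono2) auto
      finally show ?thesis by (simp add: mult_ac)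
    qed
    show "(\<lambda>x. u x s powr p) \<in> borel_measurable lborel" if "s \<in> {0..T}" for s
      using meas[OF that] by simp
  qed
qed

lemma mass: assumes "0 \<le> t" shows "(LINT x|lborel. u x t) = 1"
proof (cases "t = 0")
  case False
  with assms have "(LINT x|lborel. u x t) = (LINT x|lborel. u x 0)"
    by (intro DERIV_isconst_end[where f = "\<lambda>s. LINT x|lborel. u x s"] DERIV_mass continuous_mass) auto
  then show ?thesis by (simp add: mass_0)
qed (simp add: mass_0)

lemma entropy_pos: "0 \<le> t \<Longrightarrow> 0 < entropy t"
  by (intro integral_powr_pos integrable_entropy mass nonneg)

lemma moment_pos: "0 \<le> t \<Longrightarrow> 0 < moment t"
  using second_moment_pos[OF nonneg integrable_moment mass] by (simp add: second_moment_def)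

text \<open>The derivative of the moment is a nonnegative multiple of the integral of
  \<open>u\<close> times the square of \<open>v1\<close>. In the final estimate this keeps the
  argument of the logarithm positive.\<close>

lemma moment_mono:
  assumes "0 \<le> t" shows "moment 0 \<le> moment t"
proof (rule DERIV_nonneg_imp_increasing_open[where f = "\<lambda>s. moment s", OF assms _ continuous_moment])
  fix s :: real assume s: "0 < s"
  interpret flux_profile p "\<lambda>x. u x s" "\<lambda>x. dx u x s" "\<lambda>x. dx (dx u) x s"
    "\<lambda>x. dx (\<lambda>y s. u y s powr (p - 1)) x s" "\<lambda>x. dx (dx (\<lambda>y s. u y s powr (p - 1))) x s"
    "\<lambda>x. dx (flux p u) x s" "\<lambda>x. - (p - 1) * dt u x s"
    by (rule flux_profile[OF s])
  have "0 \<le> (LINT x|lborel. u x s * (dx (\<lambda>y s. u y s powr (p - 1)) x s)\<^sup>2)"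
    by (intro integral_nonneg_AE AE_I2) (use u_nonneg in auto)
  then have "(LINT x|lborel. flux p u x s) \<le> 0"
    using integral_w p_gt by (simp add: flux_def)
  then show "\<exists>d. ((\<lambda>s. moment s) has_real_derivative d) (at s) \<and> 0 \<le> d"
    using p_gt DERIV_moment[OF s] by (intro exI[of _ "- (2 / (p - 1)) * (LINT x|lborel. flux p u x s)"] conjI)
      (auto intro!: divide_nonpos_pos mult_nonneg_nonpos)
qed

text \<open>
  \<open>G\<close> is the entropy power normalised so that it equals the second moment for rescalings of \<open>g\<close>.
  The dissipation inequality bounds \<open>G'\<close> below by a multiple of \<open>G m\<^sup>2 / E\<^sup>2\<close>, and the
  Gagliardo-Nirenberg inequality turns this into the derivative \<open>2 m / (p - 1)\<close> of the moment.
\<close>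

lemma entropy_power_minus_moment_mono:
  assumes a: "0 < a" and g: "continuous_on UNIV g" "integrable lborel g" "(LINT x|lborel. g x) = 1"
      "\<And>y. \<bar>y\<bar> < a \<Longrightarrow> 0 < g y" "\<And>y. a \<le> \<bar>y\<bar> \<Longrightarrow> g y = 0"
    and int_g: "integrable lborel (\<lambda>y. y\<^sup>2 * g y)" "integrable lborel (\<lambda>y. g y powr p)"
    and Eg: "0 < (LINT y|lborel. g y powr p)" and Tg: "0 < (LINT y|lborel. y\<^sup>2 * g y)"
  defines "G \<equiv> (\<lambda>t. (LINT y|lborel. y\<^sup>2 * g y) * ((LINT y|lborel. g y powr p) / entropy t) powr (2 / (p - 1)))"
  assumes t: "0 \<le> t"
  shows "G 0 - moment 0 \<le> G t - moment t"
proof (rule DERIV_nonneg_imp_increasing_open[where f = "\<lambda>s. G s - moment s", OF t])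
  have ratio: "continuous_on {0..t} (\<lambda>s. (LINT y|lborel. g y powr p) / entropy s)"
    using entropy_pos by (intro continuous_intros continuous_entropy) (auto simp: less_imp_neq[symmetric])
  show "continuous_on {0..t} (\<lambda>s. G s - moment s)"
    unfolding G_def using entropy_pos Eg
    by (intro continuous_on_diff continuous_on_mult_left continuous_on_powr ratio continuous_on_const continuous_moment)
      (auto simp: less_imp_neq[symmetric])
next
  fix s :: real assume s: "0 < s"
  interpret flux_profile p "\<lambda>x. u x s" "\<lambda>x. dx u x s" "\<lambda>x. dx (dx u) x s"
    "\<lambda>x. dx (\<lambda>y s. u y s powr (p - 1)) x s" "\<lambda>x. dx (dx (\<lambda>y s. u y s powr (p - 1))) x s"
    "\<lambda>x. dx (flux p u) x s" "\<lambda>x. - (p - 1) * dt u x s"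
    by (rule flux_profile[OF s])
  \<comment> \<open>The moment has derivative \<open>2 * m / (p - 1)\<close>. The
    Gagliardo-Nirenberg bound is linear in \<open>m\<close>, the dissipation bound
    quadratic.\<close>
  define m where "m = - (LINT x|lborel. flux p u x s)"
  define J where "J = (LINT x|lborel. u x s * (dx (\<lambda>y s. u y s powr (p - 1)) x s)\<^sup>2)"
  define D where "D = (LINT x|lborel. u x s powr (p - 1) * dt u x s)"
  have E: "0 < entropy s" using entropy_pos s by simp
  have mJ: "m = p / (p - 1) * J"
    using integral_w by (simp add: m_def J_def flux_def)
  have "0 \<le> J"
    unfolding J_def by (intro integral_nonneg_AE AE_I2) (use u_nonneg in auto)
  then have m: "0 \<le> m" using p_gt by (simp add: mJ)
  have "(LINT x|lborel. u x s powr (p - 1) * (- (p - 1) * dt u x s)) = - (p - 1) * D"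
    unfolding D_def by (subst integral_mult_right_zero[symmetric]) (simp add: mult_ac)
  with entropy_dissipation[OF E] have D: "m\<^sup>2 / entropy s \<le> - (p - 1) * D"
    by (simp add: m_def flux_def)
  have "((p - 1) * entropy s)\<^sup>2 \<le> p\<^sup>2 * G s * J"
    using gagliardo_nirenberg[OF mass E a g int_g Eg Tg] s by (simp add: G_def J_def mult_ac)
  also have "\<dots> = p * (p - 1) * G s * m"
    using p_gt by (simp add: mJ power2_eq_square)
  finally have "(p - 1) * ((p - 1) * (entropy s)\<^sup>2) \<le> (p - 1) * (p * G s * m)"
    by (simp add: power2_eq_square mult_ac)
  then have GN: "(p - 1) * (entropy s)\<^sup>2 \<le> p * G s * m"
    using p_gt by simp
  have DG: "(G has_real_derivative - (2 * p / (p - 1)) * G s * D / entropy s) (at s)"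
  proof -
    let ?R = "\<lambda>s. (LINT y|lborel. g y powr p) / entropy s"
    have "(?R has_real_derivative - ?R s * (p * D) / entropy s) (at s)"
      using DERIV_divide[OF DERIV_const DERIV_entropy[OF s], of "LINT y|lborel. g y powr p"] E
      by (auto simp: D_def field_simps elim!: DERIV_cong)
    moreover have R: "0 < ?R s" using E Eg by simp
    ultimately have "((\<lambda>s. ?R s powr (2 / (p - 1))) has_real_derivative
        ?R s powr (2 / (p - 1)) * (0 * ln (?R s) + - ?R s * (p * D) / entropy s * (2 / (p - 1)) / ?R s)) (at s)"
      by (rule DERIV_powr[OF _ _ DERIV_const])
    from DERIV_cmult[OF this, of "LINT y|lborel. y\<^sup>2 * g y"] show ?thesis
      unfolding G_def
    proof (rule DERIV_cong)
      have "- r * (p * D) / e * (2 / (p - 1)) / r = - (2 * p / (p - 1)) * D / e" if "0 < r" "0 < e" for r e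
        using that p_gt by (simp add: field_simps)
      from this[OF R E] show "(LINT y|lborel. y\<^sup>2 * g y) * (?R s powr (2 / (p - 1)) *
          (0 * ln (?R s) + - ?R s * (p * D) / entropy s * (2 / (p - 1)) / ?R s)) =
        - (2 * p / (p - 1)) * ((LINT y|lborel. y\<^sup>2 * g y) * ?R s powr (2 / (p - 1))) * D / entropy s"
        by simp
    qed
  qed
  show "\<exists>d. ((\<lambda>s. G s - moment s) has_real_derivative d) (at s) \<and> 0 \<le> d"
  proof (intro exI conjI)
    show "((\<lambda>s. G s - moment s) has_real_derivative - (2 * p / (p - 1)) * G s * D / entropy s -
        - (2 / (p - 1)) * (LINT x|lborel. flux p u x s)) (at s)"
      by (rule DERIV_diff[OF DG DERIV_moment[OF s]])
    have "G s \<ge> 0" using Tg by (simp add: G_def)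
    \<comment> \<open>Multiplying \<open>GN\<close> by \<open>m\<close> creates the square that the
      dissipation bound \<open>D\<close> controls; the surplus factors \<open>entropy s\<close> are
      divided out afterwards.\<close>
    have "2 / (p - 1) * m * ((p - 1) * (entropy s)\<^sup>2) \<le> 2 / (p - 1) * m * (p * G s * m)"
      using p_gt m by (intro mult_left_mono GN) auto
    also have "\<dots> = 2 * p / (p - 1) * G s * entropy s * (m\<^sup>2 / entropy s)"
      using E by (simp add: power2_eq_square)
    also have "\<dots> \<le> 2 * p / (p - 1) * G s * entropy s * (- (p - 1) * D)"
      using p_gt E \<open>G s \<ge> 0\<close> by (intro mult_left_mono D) auto
    also have "\<dots> = (- (2 * p) * G s * D) * entropy s"
    proof -
      have *: "2 * p / r * a * e * (- r * d) = (- (2 * p) * a * d) * e" if "r \<noteq> 0" for r a d e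
        using that by simp
      show ?thesis by (rule *) (use p_gt in simp)
    qed
    also have "2 / (p - 1) * m * ((p - 1) * (entropy s)\<^sup>2) = (2 * m * entropy s) * entropy s"
      using p_gt by (simp add: power2_eq_square)
    finally have "2 * m * entropy s \<le> - (2 * p) * G s * D"
      using E by (rule mult_right_le_imp_le)
    then have "2 * m \<le> - (2 * p) * G s * D / entropy s"
      by (simp only: pos_le_divide_eq[OF E])
    then have "2 * m / (p - 1) \<le> - (2 * p) * G s * D / entropy s / (p - 1)"
      using p_gt by (intro divide_right_mono) auto
    also have "\<dots> = - (2 * p / (p - 1)) * G s * D / entropy s" by simp
    finally have "2 / (p - 1) * m \<le> - (2 * p / (p - 1)) * G s * D / entropy s" by simp
    then show "0 \<le> - (2 * p / (p - 1)) * G s * D / entropy s - - (2 / (p - 1)) * (LINT x|lborel. flux p u x s)"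
      by (simp add: m_def)
  qed
qed

end

section \<open>Barenblatt profiles\<close>

context
  fixes p C \<sigma> :: real
  assumes p: "1 < p" and C: "0 < C" and \<sigma>: "0 < \<sigma>"
begin

lemma barenblatt_nonneg: "0 \<le> barenblatt p C \<sigma> y"
  by (simp add: barenblatt_def)

lemma continuous_barenblatt: "continuous_on UNIV (barenblatt p C \<sigma>)"
  unfolding barenblatt_def using p \<sigma> by (intro continuous_on_powr' continuous_intros) auto

text \<open>The radius is the zero of the parabola inside the positive part, which \<open>eq\<close>
  factors.\<close>

lemma barenblatt_support:
  "\<bar>y\<bar> < sqrt (2 * \<sigma> * p * C / (p - 1)) \<Longrightarrow> 0 < barenblatt p C \<sigma> y"
  "sqrt (2 * \<sigma> * p * C / (p - 1)) \<le> \<bar>y\<bar> \<Longrightarrow> barenblatt p C \<sigma> y = 0"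
proof -
  let ?a = "2 * \<sigma> * p * C / (p - 1)"
  have eq: "C - (p - 1) / p * (y\<^sup>2 / (2 * \<sigma>)) = (p - 1) / (2 * \<sigma> * p) * (?a - y\<^sup>2)"
    using p \<sigma> by (simp add: field_simps)
  have pos: "0 < (p - 1) / (2 * \<sigma> * p)" using p \<sigma> by simp
  show "0 < barenblatt p C \<sigma> y" if "\<bar>y\<bar> < sqrt ?a"
  proof -
    have "y\<^sup>2 < ?a" using that real_less_rsqrt by (metis power2_abs real_sqrt_abs real_sqrt_less_iff)
    then have "0 < (p - 1) / (2 * \<sigma> * p) * (?a - y\<^sup>2)" by (intro mult_pos_pos pos) simp
    moreover have "0 < max 0 z powr b" if "0 < z" for z b :: real using that by (simp add: max_def)
    ultimately show ?thesis unfolding barenblatt_def eq by blast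
  qed
  show "barenblatt p C \<sigma> y = 0" if "sqrt ?a \<le> \<bar>y\<bar>"
  proof -
    have "?a \<le> y\<^sup>2" using that by (metis real_sqrt_abs real_sqrt_le_iff)
    then have "(p - 1) / (2 * \<sigma> * p) * (?a - y\<^sup>2) \<le> 0"
      using pos by (intro mult_nonneg_nonpos) auto
    then show ?thesis unfolding barenblatt_def eq by simp
  qed
qed

lemma barenblatt_radius_pos: "0 < sqrt (2 * \<sigma> * p * C / (p - 1))"
  using p C \<sigma> by simp

lemma rapid_barenblatt: "rapid (barenblatt p C \<sigma>)"
  unfolding rapid_def
proof
  fix k :: nat
  let ?a = "sqrt (2 * \<sigma> * p * C / (p - 1))"
  have "(1 + \<bar>y\<bar>) ^ k * \<bar>barenblatt p C \<sigma> y\<bar> \<le> (1 + ?a) ^ k * C powr (1 / (p - 1))" for y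
  proof (cases "\<bar>y\<bar> < ?a")
    case True
    have "0 \<le> (p - 1) / p * (y\<^sup>2 / (2 * \<sigma>))" using p \<sigma> by simp
    then have "max 0 (C - (p - 1) / p * (y\<^sup>2 / (2 * \<sigma>))) \<le> C" using C by linarith
    then have "\<bar>barenblatt p C \<sigma> y\<bar> \<le> C powr (1 / (p - 1))"
      unfolding barenblatt_def using p by (simp add: powr_mono2)
    with True show ?thesis by (intro mult_mono power_mono) auto
  next
    case False
    then show ?thesis using barenblatt_support(2)[of y] barenblatt_radius_pos by simp
  qed
  then show "\<exists>M. \<forall>y. (1 + \<bar>y\<bar>) ^ k * \<bar>barenblatt p C \<sigma> y\<bar> \<le> M" by blast
qed

lemma integrable_barenblatt:
  "integrable lborel (barenblatt p C \<sigma>)"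
  "integrable lborel (\<lambda>y. y\<^sup>2 * barenblatt p C \<sigma> y)"
  "integrable lborel (\<lambda>y. barenblatt p C \<sigma> y powr p)"
proof -
  show "integrable lborel (barenblatt p C \<sigma>)"
    by (intro rapid_integrable rapid_barenblatt continuous_barenblatt)
  show "integrable lborel (\<lambda>y. y\<^sup>2 * barenblatt p C \<sigma> y)"
    by (intro rapid_integrable rapid_power_mult rapid_barenblatt continuous_intros continuous_barenblatt)
  have "rapid (\<lambda>y. barenblatt p C \<sigma> y powr p)"
    using rapid_powr[OF rapid_barenblatt, of p] p barenblatt_nonneg by simp
  then show "integrable lborel (\<lambda>y. barenblatt p C \<sigma> y powr p)"
    using p barenblatt_nonneg
    by (intro rapid_integrable continuous_on_powr' continuous_barenblatt continuous_on_const) auto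
qed

text \<open>The moment condition forces \<open>\<tau> = \<sigma>\<close>; in the proof this appears as \<open>r * c = 1\<close>.\<close>

lemma integral_rescaled_barenblatt_powr:
  assumes \<tau>: "0 < \<tau>" and \<Theta>0: "0 < \<Theta>0" "second_moment (barenblatt p C \<sigma>) = \<Theta>0"
    and \<Theta>: "0 < \<Theta>" "second_moment (rescaled_barenblatt p C \<tau> \<Theta>0 \<Theta>) = \<Theta>"
  shows "(LINT x|lborel. rescaled_barenblatt p C \<tau> \<Theta>0 \<Theta> x powr p)
    = (\<Theta> / \<Theta>0) powr ((1 - p) / 2) * (LINT y|lborel. barenblatt p C \<sigma> y powr p)"
proof -
  let ?B = "barenblatt p C \<sigma>" and ?U = "rescaled_barenblatt p C \<tau> \<Theta>0 \<Theta>"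
  define r where "r = sqrt (\<Theta> / \<Theta>0)"
  \<comment> \<open>The parameter \<open>\<tau>\<close> of the rescaled profile is not yet tied to
    \<open>\<sigma>\<close>, so \<open>c\<close> combines their ratio with the dilation by
    \<open>r\<close>.\<close>
  define c where "c = sqrt (\<sigma> / \<tau>) / r"
  have r: "0 < r" "r\<^sup>2 = \<Theta> / \<Theta>0" using \<Theta> \<Theta>0 by (simp_all add: r_def)
  have c: "0 < c" "c\<^sup>2 = \<sigma> / \<tau> * (\<Theta>0 / \<Theta>)"
    using r \<sigma> \<tau> by (simp_all add: c_def power_divide)
  have U: "?U x = 1 / r * ?B (c * x)" for x
  proof -
    have "\<Theta>0 / \<Theta> * (x\<^sup>2 / (2 * \<tau>)) = (c * x)\<^sup>2 / (2 * \<sigma>)"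
      using \<sigma> by (simp add: power_mult_distrib c(2))
    moreover have "(\<Theta> / \<Theta>0) powr (- 1 / 2) = 1 / r"
      using \<Theta> \<Theta>0 by (simp add: r_def powr_minus_divide powr_half_sqrt)
    ultimately show ?thesis
      unfolding rescaled_barenblatt_def barenblatt_def mult.assoc by simp
  qed
  have subst: "(LINT x|lborel. f (c * x)) = (LINT y|lborel. f y) / c" for f :: "real \<Rightarrow> real"
    using lborel_integral_real_affine[of c f 0] c by simp
  have "\<Theta> = (LINT x|lborel. x\<^sup>2 * ?U x)"
    by (rule \<Theta>(2)[unfolded second_moment_def, symmetric])
  also have "\<dots> = (LINT x|lborel. 1 / (r * c\<^sup>2) * ((c * x)\<^sup>2 * ?B (c * x)))"
    using c(1) by (simp add: U power_mult_distrib)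
  also have "\<dots> = 1 / (r * c\<^sup>2) * (\<Theta>0 / c)"
    using subst[of "\<lambda>y. y\<^sup>2 * ?B y"] \<Theta>0(2) by (simp add: second_moment_def)
  \<comment> \<open>The left side is also \<open>r ^ 2\<close>, so this forces the cube of
    \<open>r * c\<close> to be 1.\<close>
  finally have "\<Theta> / \<Theta>0 = 1 / (r * c ^ 3)"
    using \<Theta>0(1) by (simp add: field_simps power2_eq_square power3_eq_cube)
  then have "r\<^sup>2 = 1 / (r * c ^ 3)" by (simp only: r(2))
  then have "r\<^sup>2 * (r * c ^ 3) = 1" using r(1) c(1) by simp
  then have "(r * c) ^ 3 = 1 ^ 3"
    by (simp add: power_mult_distrib power2_eq_square power3_eq_cube mult_ac)
  then have rc: "r * c = 1" using r(1) c(1) power_eq_iff_eq_base[of 3 "r * c" 1] by simp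
  have "(LINT x|lborel. ?U x powr p) = (LINT x|lborel. (1 / r) powr p * ?B (c * x) powr p)"
    using r by (simp add: U powr_mult powr_divide)
  also have "\<dots> = (1 / r) powr p * ((LINT y|lborel. ?B y powr p) / c)"
    using subst[of "\<lambda>y. ?B y powr p"] by simp
  also have "\<dots> = r powr (1 - p) * (LINT y|lborel. ?B y powr p)"
  proof -
    have "c = 1 / r" using rc r by (simp add: field_simps)
    then show ?thesis using r by (simp add: powr_divide powr_diff)
  qed
  also have "r powr (1 - p) = (\<Theta> / \<Theta>0) powr ((1 - p) / 2)"
    using \<Theta> \<Theta>0 by (simp add: r_def powr_half_sqrt[symmetric] powr_powr)
  finally show ?thesis .
qed

end

text \<open>Moving \<open>2 / (p - 1)\<close> into the logarithm leaves the factor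
  \<open>- 1 / 2\<close> and exposes the entropy power that \<open>G\<close> is built from.\<close>

lemma relative_renyi_entropy_eq_ln:
  assumes "1 < p" "0 < (LINT x|lborel. f x powr p)" "0 < (LINT x|lborel. g x powr p)"
  shows "relative_renyi_entropy p f g =
    - (1 / 2) * ln (((LINT x|lborel. g x powr p) / (LINT x|lborel. f x powr p)) powr (2 / (p - 1)))"
proof -
  have "1 / (1 - p) = - (1 / (p - 1))" using assms(1) by (simp add: field_simps)
  then show ?thesis
    unfolding relative_renyi_entropy_def renyi_entropy_def
    using assms by (simp add: ln_powr ln_div algebra_simps diff_divide_distrib)
qed

theorem mainTheorem3:
  fixes p C \<sigma> t :: real
    and \<sigma>t :: "real \<Rightarrow> real"
    and u0 :: "real \<Rightarrow> real"
    and u :: "real \<Rightarrow> real \<Rightarrow> real"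
  defines "\<Theta>0 \<equiv> second_moment u0"
    and "\<Theta> \<equiv> (\<lambda>s. second_moment (\<lambda>x. u x s))"
  defines "B \<equiv> barenblatt p C \<sigma>"
    and "U \<equiv> (\<lambda>s. rescaled_barenblatt p C (\<sigma>t s) \<Theta>0 (\<Theta> s))"
  assumes "1 < p" and "p \<le> 3 / 2"
    and "\<And>x. u0 x \<ge> 0"
    and "integrable lborel u0" and "(LINT x|lborel. u0 x) = 1"
    and "integrable lborel (\<lambda>x. x\<^sup>2 * u0 x)"
    and "solves_cauchy_problem p u0 u"
    and "smooth_for_positive_times u"
    and "\<And>x s. s \<ge> 0 \<Longrightarrow> u x s \<ge> 0"
    and "spatially_fast_decaying u"
    and "C > 0" and "\<sigma> > 0"
    and "(LINT y|lborel. B y) = 1" and "second_moment B = \<Theta>0"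
    and "\<And>s. s > 0 \<Longrightarrow> \<sigma>t s > 0 \<and> second_moment (U s) = \<Theta> s"
    and "t > 0"
  shows "relative_renyi_entropy p (\<lambda>x. u x t) (U t)
     \<le> - (1 / 2) * ln (1 - (1 - exp (- 2 * relative_renyi_entropy p u0 B)) * (\<Theta>0 / \<Theta> t))"
proof -
  have u0: "u0 = (\<lambda>x. u x 0)"
    using assms(11) by (auto simp: solves_cauchy_problem_def)
  interpret fast_decaying_solution p u
    using assms(5,9,11-14) by unfold_locales (auto simp: solves_cauchy_problem_def u0)
  have p: "0 < p - 1" "1 < p" using p_gt by auto
  have t: "0 \<le> t" using assms(20) by simp
  define E where "E = (\<lambda>s. LINT x|lborel. u x s powr p)"
  define EB where "EB = (LINT y|lborel. B y powr p)"
  define EU where "EU = (LINT x|lborel. U t x powr p)"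
  have E: "0 < E s" if "0 \<le> s" for s using entropy_pos[OF that] by (simp add: E_def)
  have EB: "0 < EB"
    unfolding EB_def B_def using assms(17)
    by (intro integral_powr_pos barenblatt_nonneg integrable_barenblatt p_gt assms(15,16)) (simp add: B_def)
  have \<Theta>_eq: "\<Theta> s = (LINT x|lborel. x\<^sup>2 * u x s)" for s by (simp add: \<Theta>_def second_moment_def)
  have \<Theta>0_eq: "\<Theta>0 = \<Theta> 0" by (simp add: \<Theta>0_def \<Theta>_def u0)
  have \<Theta>: "0 < \<Theta> s" if "0 \<le> s" for s using moment_pos[OF that] by (simp add: \<Theta>_eq)
  have B2: "(LINT y|lborel. y\<^sup>2 * B y) = \<Theta>0" using assms(18) by (simp add: second_moment_def)
  define G where "G = (\<lambda>s. \<Theta>0 * (EB / E s) powr (2 / (p - 1)))"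
  have G_pos: "0 < G s" if "0 \<le> s" for s
    using \<Theta>[of 0] E[OF that] EB by (simp add: G_def \<Theta>0_eq)
  note pC\<sigma> = p_gt assms(15,16)
  have "(LINT y|lborel. y\<^sup>2 * B y) * (EB / E 0) powr (2 / (p - 1)) - (LINT x|lborel. x\<^sup>2 * u x 0)
      \<le> (LINT y|lborel. y\<^sup>2 * B y) * (EB / E t) powr (2 / (p - 1)) - (LINT x|lborel. x\<^sup>2 * u x t)"
    unfolding E_def EB_def
  proof (rule entropy_power_minus_moment_mono)
    show "0 < sqrt (2 * \<sigma> * p * C / (p - 1))" by (rule barenblatt_radius_pos[OF pC\<sigma>])
    show "0 < (LINT y|lborel. y\<^sup>2 * B y)" using \<Theta>[of 0] by (simp add: B2 \<Theta>0_eq)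
  qed (use EB assms(17) t in \<open>simp_all add: B_def EB_def pC\<sigma> continuous_barenblatt integrable_barenblatt barenblatt_support\<close>)
  then have mono: "G 0 - \<Theta> 0 \<le> G t - \<Theta> t"
    unfolding G_def B2 \<Theta>_eq .
  have \<Theta>_mono: "\<Theta> 0 \<le> \<Theta> t" using moment_mono[OF t] by (simp add: \<Theta>_eq)
  have EU: "EU = (\<Theta> t / \<Theta>0) powr ((1 - p) / 2) * EB"
    unfolding EU_def EB_def U_def B_def
    using assms(15,16,18) assms(19)[OF assms(20)] \<Theta>[OF t] \<Theta>[of 0] p_gt
    by (intro integral_rescaled_barenblatt_powr) (auto simp: \<Theta>0_eq B_def U_def)
  \<comment> \<open>Raising the scaling factor of \<open>EU\<close> to the power
    \<open>2 / (p - 1)\<close> gives exponent \<open>- 1\<close>, which puts the current moment in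
    the denominator.\<close>
  have "(EU / E t) powr (2 / (p - 1)) = G t / \<Theta> t"
  proof -
    have "(EU / E t) powr (2 / (p - 1)) = ((\<Theta> t / \<Theta>0) powr ((1 - p) / 2)) powr (2 / (p - 1)) * (EB / E t) powr (2 / (p - 1))"
      using E[OF t] EB by (simp add: EU powr_mult[symmetric])
    also have "((\<Theta> t / \<Theta>0) powr ((1 - p) / 2)) powr (2 / (p - 1)) = (\<Theta> t / \<Theta>0) powr (- 1)"
    proof -
      have "(1 - p) / 2 * (2 / (p - 1)) = - 1" using p by (simp add: field_simps)
      then show ?thesis by (simp only: powr_powr)
    qed
    also have "\<dots> = \<Theta>0 / \<Theta> t" using \<Theta>[OF t] \<Theta>[of 0] by (simp add: powr_minus \<Theta>0_eq)
    finally show ?thesis by (simp add: G_def)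
  qed
  moreover have "0 < EU" using \<Theta>[OF t] \<Theta>[of 0] EB by (simp add: EU \<Theta>0_eq)
  ultimately have lhs: "relative_renyi_entropy p (\<lambda>x. u x t) (U t) = - (1 / 2) * ln (G t / \<Theta> t)"
    using relative_renyi_entropy_eq_ln[of p "\<lambda>x. u x t" "U t"] p E[OF t] by (simp add: E_def EU_def)
  have "relative_renyi_entropy p u0 B = - (1 / 2) * ln (G 0 / \<Theta>0)"
    using relative_renyi_entropy_eq_ln[of p u0 B] p E[of 0] EB \<Theta>[of 0]
    by (simp add: E_def EB_def u0 G_def \<Theta>0_eq)
  then have "exp (- 2 * relative_renyi_entropy p u0 B) = G 0 / \<Theta>0"
    using G_pos[of 0] \<Theta>[of 0] by (simp add: \<Theta>0_eq)
  \<comment> \<open>The argument of the logarithm becomes a quotient over the same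
    \<open>\<Theta> t\<close> as in \<open>lhs\<close>, so the claim reduces to
    \<open>mono\<close>.\<close>
  then have "1 - (1 - exp (- 2 * relative_renyi_entropy p u0 B)) * (\<Theta>0 / \<Theta> t) = (\<Theta> t - \<Theta> 0 + G 0) / \<Theta> t"
    using \<Theta>[OF t] \<Theta>[of 0] by (simp add: \<Theta>0_eq field_simps)
  moreover have "ln ((\<Theta> t - \<Theta> 0 + G 0) / \<Theta> t) \<le> ln (G t / \<Theta> t)"
    using \<Theta>_mono mono \<Theta>[OF t] G_pos[of 0] G_pos[OF t] by (subst ln_le_cancel_iff) (auto simp: divide_right_mono)
  ultimately show ?thesis by (simp add: lhs)
qed

end
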